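(* Let $0<\alpha<2$, let $\psi$ be a Bernstein function regularly varying at zero of index $\alpha/2$ with $\psi(0)=0$ and $\psi(1)=1$, and let $p$ be the one-step probability of a random walk $S$ on $\mathbb{Z}^d$ in the class $\mathscr{S}$. Let $p_\psi(x,n)$ be the transition function of the subordinate random walk $S^\psi$. Then $$p_\psi(0,n)\sim D_{d,\alpha}\,\big(\psi^{-1}(n^{-1})\big)^{d/2}$$ as $n$ tends to infinity, where $$D_{d,\alpha}=(2\pi)^{d/2}\,\frac{\Gamma(1+d/\alpha)}{\Gamma(1+d/2)}\,(\det Q)^{-1/2}.$$
   Context: Class $\mathscr{S}$: $p$ is a probability measure on $\mathbb{Z}^d$ with finite support, $\sum_vp(v)v=0$, and for each $x\in\mathbb{Z}^d$ there is $n\in\mathbb{N}$ with $p(x,n)>0$, where $p(\cdot,n)=p^{(n)}$ is the $n$-fold convolution of $p$; $S$ is the random walk started at $0$ with step law $p$. $Q$ is the matrix of the quadratic form $\langle Qu,u\rangle=\sum_vp(v)\langle v,u\rangle^2$, $u\in\mathbb{R}^d$. A Bernstein function is a function $\psi:[0,\infty)\to[0,\infty)$, continuous on $[0,\infty)$ and smooth on $(0,\infty)$, with $(-1)^n\psi^{(n)}(x)\le0$ for all integers $n\ge1$ and $x>0$. It has a representation $\psi(x)=a+bx+\int_{[0,\infty)}(1-e^{-xs})\,d\nu(s)$ with constants $a,b\ge0$ and a measure $\nu$ on $[0,\infty)$ satisfying $\int_{[0,\infty)}\min\{1,s\}\,d\nu(s)<\infty$. It is regularly varying at zero of index $\beta$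 if $\psi(x)=x^{\beta}\ell(1/x)$ near $0$, where $\ell(\lambda x)/\ell(x)\to1$ as $x\to\infty$ for every $\lambda>0$. $\psi^{-1}$ is the inverse function of $\psi$. For $k\ge1$ put $c(\psi,k)=\frac1{k!}\int_{[0,\infty)}t^ke^{-t}\,d\nu(t)+b\,\mathbf 1_{\{k=1\}}$. Let $\tau_n=R_1+\dots+R_n$ with $R_i$ i.i.d., independent of $S$, $\mathbb{P}(R_i=k)=c(\psi,k)$. The subordinate random walk is $S^\psi_n=S_{\tau_n}$ (in law) and $p_\psi(x,n)=\mathbb{P}(S^\psi_n=x)=\sum_{k\ge n}p(x,k)\mathbb{P}(\tau_n=k)$. $f\sim g$ means $f/g\to1$.
   Formalization: The constant is corrected: the factor (2π)^{d/2} in D_{d,α} is replaced by (2π)^{-d/2}; as printed the claim is false, e.g. for d=1, simple random walk and ψ(x)=√x, where n·p_ψ(0,n) tends to √2/π and not to 2√2. *)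

theory Defs
  imports "HOL-Probability.Probability" "HOL-Library.Landau_Symbols"
begin

primrec conv_pow :: "nat \<Rightarrow> 'a::monoid_add pmf \<Rightarrow> 'a pmf" where
  "conv_pow 0 p = return_pmf 0"
| "conv_pow (Suc n) p =
     bind_pmf (conv_pow n p) (\<lambda>x. bind_pmf p (\<lambda>y. return_pmf (x + y)))"

definition real_vec :: "int ^ 'd \<Rightarrow> real ^ 'd::finite" where
  "real_vec v = (\<chi> i. real_of_int (v $ i))"

definition class_S :: "(int ^ 'd::finite) pmf \<Rightarrow> bool" where
  "class_S p \<longleftrightarrow>
     finite (set_pmf p) \<and>
     (\<Sum>v\<in>set_pmf p. pmf p v *\<^sub>R real_vec v) = 0 \<and>
     (\<forall>x. \<exists>n. pmf (conv_pow n p) x > 0)"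

text \<open>The entries of the symmetric matrix of the quadratic form
  \<open>u \<mapsto> (\<Sum>v. p v * (v \<bullet> u)\<^sup>2)\<close>; see \<open>cov_matrix_unique\<close>.\<close>

definition cov_matrix :: "(int ^ 'd::finite) pmf \<Rightarrow> real ^ 'd ^ 'd" where
  "cov_matrix p =
     (\<chi> i j. \<Sum>v\<in>set_pmf p. pmf p v * (real_vec v $ i * real_vec v $ j))"

lemma transpose_cov_matrix: "transpose (cov_matrix p) = cov_matrix p"
  by (simp add: cov_matrix_def transpose_def vec_eq_iff mult.commute)

lemma cov_matrix_quadratic_form:
  "(cov_matrix p *v u) \<bullet> u = (\<Sum>v\<in>set_pmf p. pmf p v * (real_vec v \<bullet> u)\<^sup>2)"
proof -
  have sq: "(real_vec v \<bullet> u)\<^sup>2 =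
      (\<Sum>i\<in>UNIV. \<Sum>j\<in>UNIV. (real_vec v $ i * u $ i) * (real_vec v $ j * u $ j))" for v
    by (simp only: inner_vec_def inner_real_def power2_eq_square sum_product)
  have "(cov_matrix p *v u) \<bullet> u =
      (\<Sum>i\<in>UNIV. \<Sum>j\<in>UNIV. \<Sum>v\<in>set_pmf p.
         pmf p v * ((real_vec v $ i * u $ i) * (real_vec v $ j * u $ j)))"
    by (simp add: cov_matrix_def inner_vec_def matrix_vector_mult_def sum_distrib_left
        sum_distrib_right mult_ac)
  also have "\<dots> = (\<Sum>i\<in>UNIV. \<Sum>v\<in>set_pmf p. \<Sum>j\<in>UNIV.
         pmf p v * ((real_vec v $ i * u $ i) * (real_vec v $ j * u $ j)))"
    by (intro sum.cong refl sum.swap)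
  also have "\<dots> = (\<Sum>v\<in>set_pmf p. \<Sum>i\<in>UNIV. \<Sum>j\<in>UNIV.
         pmf p v * ((real_vec v $ i * u $ i) * (real_vec v $ j * u $ j)))"
    by (rule sum.swap)
  also have "\<dots> = (\<Sum>v\<in>set_pmf p. pmf p v * (real_vec v \<bullet> u)\<^sup>2)"
    by (simp only: sq) (simp only: sum_distrib_left)
  finally show ?thesis .
qed

lemma cov_matrix_unique:
  fixes A :: "real ^ 'd::finite ^ 'd"
  assumes "transpose A = A"
    and "\<And>u. (A *v u) \<bullet> u = (\<Sum>v\<in>set_pmf p. pmf p v * (real_vec v \<bullet> u)\<^sup>2)"
  shows "A = cov_matrix p"
proof -
  define B where "B = A - cov_matrix p"
  have symA: "(A *v x) \<bullet> y = (A *v y) \<bullet> x" for x y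
    using assms(1) by (metis dot_lmul_matrix inner_commute transpose_matrix_vector)
  have symC: "(cov_matrix p *v x) \<bullet> y = (cov_matrix p *v y) \<bullet> x" for x y
    by (metis dot_lmul_matrix inner_commute transpose_matrix_vector transpose_cov_matrix)
  have symB: "(B *v x) \<bullet> y = (B *v y) \<bullet> x" for x y
    using symA[of x y] symC[of x y]
    by (simp add: B_def matrix_vector_mult_diff_rdistrib inner_diff_left)
  have zero: "(B *v u) \<bullet> u = 0" for u
    by (simp add: B_def matrix_vector_mult_diff_rdistrib inner_diff_left assms(2)
        cov_matrix_quadratic_form)
  have "(B *v x) \<bullet> y = 0" for x y
    using zero[of "x + y"] zero[of x] zero[of y] symB[of x y]
    by (simp add: matrix_vector_right_distrib inner_add_left inner_add_right)
  hence "B *v x = 0" for x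
    by (metis inner_eq_zero_iff)
  hence "B = 0"
    by (metis matrix_eq matrix_vector_mult_0)
  thus ?thesis by (simp add: B_def)
qed

definition bernstein :: "(real \<Rightarrow> real) \<Rightarrow> bool" where
  "bernstein \<psi> \<longleftrightarrow>
     (\<forall>x\<ge>0. \<psi> x \<ge> 0) \<and>
     continuous_on {0..} \<psi> \<and>
     (\<forall>n. \<forall>x>0. (deriv ^^ n) \<psi> field_differentiable (at x)) \<and>
     (\<forall>n\<ge>1. \<forall>x>0. (-1) ^ n * (deriv ^^ n) \<psi> x \<le> 0)"

definition bernstein_repr :: "(real \<Rightarrow> real) \<Rightarrow> real \<Rightarrow> real \<Rightarrow> real measure \<Rightarrow> bool" where
  "bernstein_repr \<psi> a b \<nu> \<longleftrightarrow>
     a \<ge> 0 \<and> b \<ge> 0 \<and>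
     sets \<nu> = sets (restrict_space borel {0..}) \<and>
     (\<integral>\<^sup>+ s. ennreal (min 1 s) \<partial>\<nu>) < \<infinity> \<and>
     (\<forall>x\<ge>0. \<psi> x = a + b * x + (\<integral>s. (1 - exp (- (x * s))) \<partial>\<nu>))"

definition slowly_varying :: "(real \<Rightarrow> real) \<Rightarrow> bool" where
  "slowly_varying l \<longleftrightarrow> (\<forall>c>0. ((\<lambda>x. l (c * x) / l x) \<longlongrightarrow> 1) at_top)"

definition regularly_varying_at_0 :: "(real \<Rightarrow> real) \<Rightarrow> real \<Rightarrow> bool" where
  "regularly_varying_at_0 f \<beta> \<longleftrightarrow>
     (\<exists>l. slowly_varying l \<and> (\<forall>\<^sub>F x in at_right 0. f x = x powr \<beta> * l (1 / x)))"

definition bernstein_coeff :: "real \<Rightarrow> real measure \<Rightarrow> nat \<Rightarrow> real" where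
  "bernstein_coeff b \<nu> k =
     1 / fact k * (\<integral>t. t ^ k * exp (- t) \<partial>\<nu>) + (if k = 1 then b else 0)"

text \<open>The law of \<open>R\<^sub>1\<close>, supported on \<open>{1..}\<close>. By \<open>pmf_subordinator_step\<close> below the
  coefficients sum to 1 for a normalized Bernstein function, so that
  \<^const>\<open>embed_pmf\<close> is not applied outside its domain.\<close>

definition subordinator_step :: "real \<Rightarrow> real measure \<Rightarrow> nat pmf" where
  "subordinator_step b \<nu> = embed_pmf (\<lambda>k. if k = 0 then 0 else bernstein_coeff b \<nu> k)"

lemma pmf_subordinator_step:
  assumes "bernstein_repr \<psi> a b \<nu>" "\<psi> 0 = 0" "\<psi> 1 = 1"
  shows "pmf (subordinator_step b \<nu>) k = (if k = 0 then 0 else bernstein_coeff b \<nu> k)"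
proof -
  note r = assms(1)[unfolded bernstein_repr_def]
  have sets [measurable_cong]: "sets \<nu> = sets (restrict_space borel {0..})" using r by simp
  have sp: "space \<nu> = {0..}" using sets_eq_imp_space_eq[OF sets] by (simp add: space_restrict_space)
  have b: "b \<ge> 0" using r by simp
  have a: "a = 0" using r assms(2) by auto
  have m: "f \<in> borel_measurable \<nu>" if "f \<in> borel_measurable borel" for f :: "real \<Rightarrow> real"
    using that measurable_cong_sets[OF sets refl] by (auto intro: measurable_restrict_space1)
  have ae: "AE s in \<nu>. s \<ge> 0" using sp by (auto intro!: AE_I2)
  have Imin: "integrable \<nu> (\<lambda>s. min 1 s)"
  proof (rule integrableI_nonneg)
    show "(\<lambda>s. min 1 s) \<in> borel_measurable \<nu>" by (rule m) simp
    show "AE s in \<nu>. 0 \<le> min 1 s" using ae by eventually_elim simp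
    show "(\<integral>\<^sup>+ s. ennreal (min 1 s) \<partial>\<nu>) < \<infinity>" using r by simp
  qed
  have I1: "integrable \<nu> (\<lambda>s. 1 - exp (- s))"
  proof (rule Bochner_Integration.integrable_bound[OF Imin])
    show "(\<lambda>s. 1 - exp (- s)) \<in> borel_measurable \<nu>" by (rule m) simp
    have H: "norm (1 - exp (- s)) \<le> norm (min 1 s)" if "s \<ge> 0" for s :: real
      using that exp_ge_add_one_self[of "- s"] by (auto simp: min_def)
    show "AE s in \<nu>. norm (1 - exp (- s)) \<le> norm (min 1 s)" by (rule eventually_mono[OF ae H])
  qed
  define g where "g = (\<lambda>(k::nat) s::real. s ^ Suc k * exp (- s) / fact (Suc k))"
  have gm: "g k \<in> borel_measurable \<nu>" for k unfolding g_def by (rule m) measurable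
  have gs: "(\<lambda>k. g k s) sums (1 - exp (- s))" for s
  proof -
    have "(\<lambda>k. s ^ k / fact k) sums exp s"
      using exp_converges[of s] by (simp add: scaleR_conv_of_real divide_inverse mult.commute)
    hence "(\<lambda>k. s ^ Suc k / fact (Suc k)) sums (exp s - 1)"
      by (subst sums_Suc_iff) simp
    from sums_mult2[OF this, of "exp (- s)"] show ?thesis
      unfolding g_def by (simp add: algebra_simps exp_minus field_simps)
  qed
  have gnn: "g k s \<ge> 0" if "s \<ge> 0" for k s using that by (simp add: g_def)
  have gle: "g k s \<le> 1 - exp (- s)" if "s \<ge> 0" for k s
  proof -
    have "sum (\<lambda>k. g k s) {k} \<le> (\<Sum>k. g k s)"
      by (rule sum_le_suminf) (use gs gnn that in \<open>auto simp: sums_iff\<close>)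
    thus ?thesis using gs[of s] by (simp add: sums_iff)
  qed
  have gi: "integrable \<nu> (g k)" for k
  proof (rule Bochner_Integration.integrable_bound[OF I1 gm])
    have H: "norm (g k s) \<le> norm (1 - exp (- s))" if "s \<ge> 0" for s
      using gnn[OF that, of k] gle[OF that, of k] by simp
    show "AE s in \<nu>. norm (g k s) \<le> norm (1 - exp (- s))" by (rule eventually_mono[OF ae H])
  qed
  have coeff: "bernstein_coeff b \<nu> (Suc k) = (\<integral>s. g k s \<partial>\<nu>) + (if k = 0 then b else 0)" for k
  proof -
    have "(\<integral>s. g k s \<partial>\<nu>) = (\<integral>s. (1 / fact (Suc k)) * (s ^ Suc k * exp (- s)) \<partial>\<nu>)"
      by (intro Bochner_Integration.integral_cong) (auto simp: g_def)
    also have "\<dots> = 1 / fact (Suc k) * (\<integral>s. s ^ Suc k * exp (- s) \<partial>\<nu>)" by simp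
    finally show ?thesis by (simp add: bernstein_coeff_def)
  qed
  have Inn: "(\<integral>s. g k s \<partial>\<nu>) \<ge> 0" for k
    by (rule integral_nonneg_AE) (use ae gnn in auto)
  have cnn: "(if k = 0 then 0 else bernstein_coeff b \<nu> k) \<ge> 0" for k
    using Inn b coeff by (cases k) auto
  have psi1: "b + (\<integral>s. (1 - exp (- s)) \<partial>\<nu>) = 1"
    using r assms(3) a by auto
  have "(\<integral>\<^sup>+ k. ennreal (if k = 0 then 0 else bernstein_coeff b \<nu> k) \<partial>count_space UNIV)
      = (\<Sum>k. ennreal (if k = 0 then 0 else bernstein_coeff b \<nu> k))"
    by (rule nn_integral_count_space_nat)
  also have "\<dots> = (\<Sum>k. ennreal (bernstein_coeff b \<nu> (Suc k)))"
    by (subst suminf_offset[where i = 1]) auto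
  also have "\<dots> = (\<Sum>k. (\<integral>\<^sup>+ s. ennreal (g k s) \<partial>\<nu>) + ennreal (if k = 0 then b else 0))"
  proof (intro suminf_cong)
    fix k
    have "(\<integral>\<^sup>+ s. ennreal (g k s) \<partial>\<nu>) = ennreal (\<integral>s. g k s \<partial>\<nu>)"
      by (rule nn_integral_eq_integral[OF gi]) (use ae gnn in auto)
    thus "ennreal (bernstein_coeff b \<nu> (Suc k))
        = (\<integral>\<^sup>+ s. ennreal (g k s) \<partial>\<nu>) + ennreal (if k = 0 then b else 0)"
      using Inn[of k] b by (simp add: coeff ennreal_plus)
  qed
  also have "\<dots> = (\<Sum>k. \<integral>\<^sup>+ s. ennreal (g k s) \<partial>\<nu>) + (\<Sum>k. ennreal (if k = 0 then b else 0))"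
    by (rule suminf_add[symmetric]) auto
  also have "(\<Sum>k. ennreal (if k = 0 then b else 0)) = ennreal b"
    by (subst suminf_finite[where N = "{0}"]) auto
  also have "(\<Sum>k. \<integral>\<^sup>+ s. ennreal (g k s) \<partial>\<nu>) = (\<integral>\<^sup>+ s. (\<Sum>k. ennreal (g k s)) \<partial>\<nu>)"
    by (rule nn_integral_suminf[symmetric]) (use gm in measurable)
  also have "\<dots> = (\<integral>\<^sup>+ s. ennreal (1 - exp (- s)) \<partial>\<nu>)"
  proof (rule nn_integral_cong)
    fix s assume "s \<in> space \<nu>"
    thus "(\<Sum>k. ennreal (g k s)) = ennreal (1 - exp (- s))"
      using gs[of s] gnn sp by (subst suminf_ennreal2) (auto simp: sums_iff)
  qed
  also have "\<dots> = ennreal (\<integral>s. (1 - exp (- s)) \<partial>\<nu>)"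
    by (rule nn_integral_eq_integral[OF I1]) (use ae in auto)
  also have "\<dots> + ennreal b = 1"
  proof -
    have "(\<integral>s. (1 - exp (- s)) \<partial>\<nu>) \<ge> 0" by (rule integral_nonneg_AE) (use ae in auto)
    thus ?thesis using b psi1 by (simp add: ennreal_plus[symmetric] add.commute del: ennreal_plus)
  qed
  finally show ?thesis
    unfolding subordinator_step_def by (intro pmf_embed_pmf cnn)
qed

text \<open>The law of \<open>S\<close> at the independent random time \<open>\<tau>\<^sub>n\<close>; the usual series for it
  is \<open>pmf_subordinate_walk\<close>.\<close>

definition subordinate_walk ::
    "(int ^ 'd::finite) pmf \<Rightarrow> real \<Rightarrow> real measure \<Rightarrow> nat \<Rightarrow> (int ^ 'd) pmf" where
  "subordinate_walk p b \<nu> n =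
     bind_pmf (conv_pow n (subordinator_step b \<nu>)) (\<lambda>k. conv_pow k p)"

lemma conv_pow_ge:
  fixes r :: "nat pmf"
  assumes "pmf r 0 = 0" "k \<in> set_pmf (conv_pow n r)"
  shows "n \<le> k"
  using assms(2)
proof (induction n arbitrary: k)
  case (Suc n)
  then obtain x y where "x \<in> set_pmf (conv_pow n r)" "y \<in> set_pmf r" "k = x + y"
    by auto
  moreover from this assms(1) have "y > 0" by (cases y) (auto simp: set_pmf_iff)
  ultimately show ?case using Suc.IH[of x] by simp
qed simp

lemma pmf_subordinate_walk:
  assumes "bernstein_repr \<psi> a b \<nu>" "\<psi> 0 = 0" "\<psi> 1 = 1"
  shows "((\<lambda>k. pmf (conv_pow k p) x * pmf (conv_pow n (subordinator_step b \<nu>)) k)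
           has_sum pmf (subordinate_walk p b \<nu> n) x) {n..}"
proof -
  let ?r = "conv_pow n (subordinator_step b \<nu>)"
  let ?f = "\<lambda>k. pmf (conv_pow k p) x * pmf ?r k"
  have "integrable (measure_pmf ?r) (\<lambda>k. pmf (conv_pow k p) x)"
    by (rule measure_pmf.integrable_const_bound[where B = 1]) (auto simp: pmf_le_1)
  hence int: "integrable (count_space UNIV) ?f"
    by (simp add: measure_pmf_eq_density integrable_density mult.commute)
  have "pmf (subordinate_walk p b \<nu> n) x = (\<integral>k. pmf (conv_pow k p) x \<partial>measure_pmf ?r)"
    by (simp add: subordinate_walk_def pmf_bind)
  also have "\<dots> = (\<integral>k. ?f k \<partial>count_space UNIV)"
    by (simp add: measure_pmf_eq_density integral_density mult.commute)
  finally have eq: "pmf (subordinate_walk p b \<nu> n) x = (\<integral>k. ?f k \<partial>count_space UNIV)" .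
  have s: "?f sums (\<integral>k. ?f k \<partial>count_space UNIV)"
    using int by (rule sums_integral_count_space_nat)
  have "(?f has_sum (\<integral>k. ?f k \<partial>count_space UNIV)) UNIV"
    using s by (rule sums_nonneg_imp_has_sum) simp
  moreover have "pmf ?r k = 0" if "k < n" for k
    using conv_pow_ge[of "subordinator_step b \<nu>" k n] pmf_subordinator_step[OF assms, of 0] that
    by (auto simp: set_pmf_iff)
  ultimately show ?thesis
    unfolding eq by (subst has_sum_cong_neutral[where T = UNIV and g = ?f]) (auto simp: not_le)
qed

text \<open>The exponent of \<open>2 * pi\<close> is \<open>- d / 2\<close>: the Fourier integral is
  \<open>(2 pi) powr (- d) * \<integral> exp (- n \<psi> ((Q u \<bullet> u) / 2)) du\<close>, and substituting
  \<open>u = sqrt 2 Q\<^sup>-\<^sup>1\<^sup>/\<^sup>2 w\<close> gives the factor \<open>2 powr (d / 2)\<close>, while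
  \<open>\<integral> exp (- norm w powr \<alpha>) dw\<close> gives \<open>pi powr (d / 2)\<close> and the quotient of Gamma values.
  A positive exponent \<open>d / 2\<close> would be wrong: for the simple walk on the integers and
  \<open>\<psi> = sqrt\<close> the return probability is asymptotic to \<open>sqrt 2 / (pi n)\<close>.\<close>

definition D_const :: "real \<Rightarrow> real ^ 'd::finite ^ 'd \<Rightarrow> real" where
  "D_const \<alpha> Q =
     (2 * pi) powr (- (real CARD('d) / 2))
     * (Gamma (1 + real CARD('d) / \<alpha>) / Gamma (1 + real CARD('d) / 2))
     * det Q powr (- (1 / 2))"

end

theory Submission
  imports Defs
begin

text \<open>
  By Fourier inversion \<open>(2 \<pi>)\<^sup>d p\<^sub>\<psi>(0, n)\<close> is the integral over the cube \<open>[-\<pi>, \<pi>]\<^sup>d\<close> of the \<open>n\<close>-th power of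
  the characteristic function \<open>1 - \<psi>(1 - \<phi>(\<xi>))\<close> of one step, where \<open>\<phi>\<close> is the characteristic
  function of \<open>p\<close> and \<open>\<psi>\<close> is extended to the right half-plane by its integral representation.
  With \<open>x\<^sub>n = \<psi>\<^sup>-\<^sup>1(1/n)\<close> substitute \<open>\<xi> = sqrt x\<^sub>n u\<close>. Since \<open>1 - \<phi>(\<xi>)\<close> is \<open>\<langle>Q \<xi>, \<xi>\<rangle> / 2\<close> up to a
  cubic error and \<open>\<bar>\<psi>(x + iy) - \<psi>(x)\<bar> \<le> \<bar>y\<bar> / x * \<psi>(x)\<close>, regular variation gives pointwise
  convergence of the integrand to \<open>exp (- (\<langle>Q u, u\<rangle> / 2) powr (\<alpha> / 2))\<close>. A lower Potter bound for \<open>\<psi>\<close>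
  near 0, together with compactness of the cube away from 0, provides an integrable majorant, and
  the limit integral is computed from the volumes of ellipsoids.
\<close>

subsection \<open>Regular variation at zero\<close>

text \<open>The hypothesis only gives limits of ratios of \<psi> at fixed dilations. Uniformity
  comes from monotonicity of \<psi>: squeezing between fixed dilations handles moving arguments, and
  repeated doubling gives the lower bound. The walk need not be symmetric, so its characteristic
  function is complex and \<psi> has to be compared at x + iy and at x; an error bound relative to
  \<open>\<psi> x\<close> is what survives multiplication by n. The scale is dictated by
  \<open>real n * \<psi> (x n) = 1\<close>: it turns n times a value of \<psi> into a ratio to which
  regular variation applies, and the Jacobian of the substitution is the claimed rate
  \<open>x n powr (d / 2)\<close>. The walk may be periodic, so the characteristic function of p can
  have modulus 1 away from frequency 0; randomizing the time pushes the modulus strictly below 1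
  there. This would fail for the identity as \<psi>, where the random time is deterministic, and the
  index \<alpha> / 2 < 1 excludes that case.\<close>

lemma regularly_varying_ratio:
  assumes rv: "regularly_varying_at_0 \<psi> \<beta>" and pos: "\<And>x. x > 0 \<Longrightarrow> \<psi> x > 0" and c: "c > 0"
  shows "((\<lambda>x. \<psi> (c * x) / \<psi> x) \<longlongrightarrow> c powr \<beta>) (at_right 0)"
proof -
  from rv obtain l where l: "slowly_varying l" "\<forall>\<^sub>F x in at_right 0. \<psi> x = x powr \<beta> * l (1 / x)"
    unfolding regularly_varying_at_0_def by blast
  have inv: "filterlim (\<lambda>x::real. 1 / x) at_top (at_right 0)"
    using filterlim_inverse_at_top_right by (simp add: inverse_eq_divide)
  have "((\<lambda>x. l (1 / c * x) / l x) \<longlongrightarrow> 1) at_top"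
    using l(1)[unfolded slowly_varying_def, rule_format, of "1 / c"] c by simp
  from filterlim_compose[OF this inv]
  have "((\<lambda>x. c powr \<beta> * (l (1 / (c * x)) / l (1 / x))) \<longlongrightarrow> c powr \<beta> * 1) (at_right 0)"
    by (intro tendsto_mult tendsto_const) simp
  moreover have "\<forall>\<^sub>F x in at_right 0. c powr \<beta> * (l (1 / (c * x)) / l (1 / x)) = \<psi> (c * x) / \<psi> x"
  proof -
    have "filterlim (\<lambda>x. c * x) (at_right 0) (at_right 0)"
    proof (subst filterlim_at, intro conjI)
      show "((\<lambda>x. c * x) \<longlongrightarrow> 0) (at_right 0)" by (auto intro!: tendsto_eq_intros)
      show "\<forall>\<^sub>F x in at_right 0. c * x \<in> {0<..} \<and> c * x \<noteq> 0"
        using eventually_at_right_less[of "0::real"] by eventually_elim (use c in auto)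
    qed
    hence "\<forall>\<^sub>F x in at_right 0. \<psi> (c * x) = (c * x) powr \<beta> * l (1 / (c * x))"
      using l(2) by (rule eventually_compose_filterlim[rotated])
    with l(2) eventually_at_right_less[of "0::real"] show ?thesis
    proof eventually_elim
      case (elim x)
      thus ?case using c by (simp add: powr_mult)
    qed
  qed
  ultimately show ?thesis by (simp add: tendsto_cong)
qed

text \<open>The multiplier \<open>c n\<close> moves with n, so
  \<open>regularly_varying_ratio\<close> does not apply directly. As \<psi> is increasing, the value
  at \<open>c n * x n\<close> is squeezed between those at fixed multipliers on either side of
  \<open>q\<close>, and continuity of \<open>t powr \<beta>\<close> at \<open>q\<close> closes the
  gap.\<close>

lemma regularly_varying_tendsto:
  assumes rv: "regularly_varying_at_0 \<psi> \<beta>" and pos: "\<And>x. x > 0 \<Longrightarrow> \<psi> x > 0"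
    and mono: "mono_on {0..} \<psi>"
    and x: "filterlim x (at_right 0) F" and c: "(c \<longlongrightarrow> q) F" and q: "q > 0"
  shows "((\<lambda>n. \<psi> (c n * x n) / \<psi> (x n)) \<longlongrightarrow> q powr \<beta>) F"
proof (rule order_tendstoI)
  have cont: "((\<lambda>t. t powr \<beta>) \<longlongrightarrow> q powr \<beta>) (at q)" using q by (intro tendsto_powr tendsto_ident_at tendsto_const) auto
  have lim: "((\<lambda>n. \<psi> (t * x n) / \<psi> (x n)) \<longlongrightarrow> t powr \<beta>) F" if "t > 0" for t
    using filterlim_compose[OF regularly_varying_ratio[OF rv pos that] x] by simp
  have xpos: "\<forall>\<^sub>F n in F. x n > 0"
    using x unfolding filterlim_at by (auto elim: eventually_mono)
  have cpos: "\<forall>\<^sub>F n in F. c n > 0" using c q by (rule order_tendstoD)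
  {
    fix y assume "y < q powr \<beta>"
    hence "\<forall>\<^sub>F t in at_left q. y < t powr \<beta>"
      using cont by (intro order_tendstoD(1)[of _ "q powr \<beta>"])
        (auto intro: filterlim_mono at_le)
    moreover have "\<forall>\<^sub>F t in at_left q. 0 < t \<and> t < q" using eventually_at_left_real[OF q] by simp
    ultimately obtain t where t: "y < t powr \<beta>" "0 < t" "t < q"
      by (metis (mono_tags, lifting) eventually_conj eventually_happens trivial_limit_at_left_real)
    have "\<forall>\<^sub>F n in F. y < \<psi> (t * x n) / \<psi> (x n)" using lim[OF t(2)] t(1) by (rule order_tendstoD)
    moreover have "\<forall>\<^sub>F n in F. t < c n" using c t(3) by (rule order_tendstoD)
    ultimately show "\<forall>\<^sub>F n in F. y < \<psi> (c n * x n) / \<psi> (x n)" using xpos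
    proof eventually_elim
      case (elim n)
      have "\<psi> (t * x n) \<le> \<psi> (c n * x n)" using elim t by (intro mono_onD[OF mono]) auto
      hence "\<psi> (t * x n) / \<psi> (x n) \<le> \<psi> (c n * x n) / \<psi> (x n)"
        using pos[of "x n"] elim by (intro divide_right_mono) auto
      thus ?case using elim by simp
    qed
  next
    fix y assume "q powr \<beta> < y"
    hence "\<forall>\<^sub>F t in at_right q. t powr \<beta> < y"
      using cont by (intro order_tendstoD(2)[of _ "q powr \<beta>"])
        (auto intro: filterlim_mono at_le)
    moreover have "\<forall>\<^sub>F t in at_right q. q < t" by (rule eventually_at_right_less)
    ultimately obtain t where t: "t powr \<beta> < y" "q < t"
      by (metis (mono_tags, lifting) eventually_conj eventually_happens trivial_limit_at_right_real)
    have "\<forall>\<^sub>F n in F. \<psi> (t * x n) / \<psi> (x n) < y" using lim[of t] t q by (intro order_tendstoD) auto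
    moreover have "\<forall>\<^sub>F n in F. c n < t" using c t(2) by (rule order_tendstoD)
    ultimately show "\<forall>\<^sub>F n in F. \<psi> (c n * x n) / \<psi> (x n) < y" using xpos cpos
    proof eventually_elim
      case (elim n)
      have "\<psi> (c n * x n) \<le> \<psi> (t * x n)" using elim t by (intro mono_onD[OF mono]) auto
      hence "\<psi> (c n * x n) / \<psi> (x n) \<le> \<psi> (t * x n) / \<psi> (x n)"
        using pos[of "x n"] elim by (intro divide_right_mono) auto
      thus ?case using elim by simp
    qed
  }
qed

text \<open>A one-sided Potter bound. The exponent \<open>\<beta> / 2\<close> leaves room below the
  limit \<open>2 powr \<beta>\<close> of the doubling ratio, and a positive exponent is all that
  integrability of the later majorant asks for.\<close>

lemma potter_lower_bound:
  assumes rv: "regularly_varying_at_0 \<psi> \<beta>" and pos: "\<And>x. x > 0 \<Longrightarrow> \<psi> x > 0"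
    and mono: "mono_on {0..} \<psi>" and \<beta>: "\<beta> > 0" and M: "M > 0"
  obtains C where "C > 0" "\<And>x y. 0 < x \<Longrightarrow> x \<le> y \<Longrightarrow> y \<le> M \<Longrightarrow> \<psi> y \<ge> C * (y / x) powr (\<beta> / 2) * \<psi> x"
proof -
  define \<gamma> where "\<gamma> = \<beta> / 2"
  have \<gamma>: "\<gamma> > 0" using \<beta> by (simp add: \<gamma>_def)
  have "\<forall>\<^sub>F x in at_right 0. 2 powr \<gamma> < \<psi> (2 * x) / \<psi> x"
    using regularly_varying_ratio[OF rv pos, of 2] by (rule order_tendstoD) (use \<beta> in \<open>auto simp: \<gamma>_def\<close>)
  then obtain x1 where x1: "x1 > 0" "\<And>x. 0 < x \<Longrightarrow> x < x1 \<Longrightarrow> 2 powr \<gamma> < \<psi> (2 * x) / \<psi> x"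
    unfolding eventually_at_right_field by auto
  define x0 where "x0 = min (x1 / 2) M"
  have x0: "x0 > 0" "x0 \<le> M" using x1 M by (auto simp: x0_def)
  \<comment> \<open>Near 0 doubling the argument multiplies \<open>\<psi>\<close> by at least \<open>2 powr (\<beta> / 2)\<close>; this is then iterated.\<close>
  have dbl: "2 powr \<gamma> * \<psi> x \<le> \<psi> (2 * x)" if "0 < x" "x \<le> x0" for x
  proof -
    have "2 powr \<gamma> < \<psi> (2 * x) / \<psi> x" using that x1 by (intro x1(2)) (auto simp: x0_def)
    thus ?thesis using pos[OF that(1)] by (simp add: field_simps)
  qed
  have iter: "\<psi> (2 ^ k * x) \<ge> (2 ^ k) powr \<gamma> * \<psi> x" if "0 < x" "2 ^ k * x \<le> x0" for x and k :: nat
    using that(2)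
  proof (induction k)
    case (Suc k)
    have "2 ^ k * x \<le> 2 ^ Suc k * x" using that(1) by simp
    hence le: "2 ^ k * x \<le> x0" using Suc.prems by linarith
    have "(2 ^ Suc k) powr \<gamma> * \<psi> x = 2 powr \<gamma> * ((2 ^ k) powr \<gamma> * \<psi> x)" by (simp add: powr_mult)
    also have "\<dots> \<le> 2 powr \<gamma> * \<psi> (2 ^ k * x)" using Suc.IH[OF le] by simp
    also have "\<dots> \<le> \<psi> (2 * (2 ^ k * x))" using that(1) le by (intro dbl) auto
    finally show ?case by (simp add: mult_ac)
  qed simp
  \<comment> \<open>One factor of 2 is lost when y / x is rounded down to a power of 2.\<close>
  define C0 where "C0 = 2 powr (- \<gamma>)"
  have small: "\<psi> y \<ge> C0 * (y / x) powr \<gamma> * \<psi> x" if "0 < x" "x \<le> y" "y \<le> x0" for x y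
  proof -
    have yx: "y / x \<ge> 1" using that by simp
    define k where "k = nat \<lfloor>log 2 (y / x)\<rfloor>"
    have "log 2 (y / x) \<ge> 0" using yx by simp
    hence "real k \<le> log 2 (y / x)" "log 2 (y / x) < real (Suc k)" by (simp_all add: k_def) linarith
    hence "2 powr real k \<le> y / x" "y / x < 2 powr real (Suc k)"
      using yx by (simp_all add: le_log_iff log_less_iff)
    hence k: "2 ^ k \<le> y / x" "y / x < 2 ^ Suc k" by (simp_all only: powr_realpow zero_less_numeral)
    have le: "2 ^ k * x \<le> y" using k that by (simp add: field_simps)
    have "(y / x) powr \<gamma> \<le> (2 ^ Suc k) powr \<gamma>" using k \<gamma> that by (intro powr_mono2) auto
    also have "\<dots> = 2 powr \<gamma> * (2 ^ k) powr \<gamma>" by (simp add: powr_mult)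
    finally have "C0 * (y / x) powr \<gamma> \<le> (2 ^ k) powr \<gamma>"
      by (simp add: C0_def powr_minus field_simps)
    hence "C0 * (y / x) powr \<gamma> * \<psi> x \<le> (2 ^ k) powr \<gamma> * \<psi> x"
      using pos[OF that(1)] by (intro mult_right_mono) auto
    also have "\<dots> \<le> \<psi> (2 ^ k * x)" using that le by (intro iter) auto
    also have "\<dots> \<le> \<psi> y" using that le by (intro mono_onD[OF mono]) auto
    finally show ?thesis .
  qed
  \<comment> \<open>Above \<open>x0\<close> only monotonicity is available. Since y <= M, the ratio
    y / x exceeds x0 / x by at most the factor M / x0, which \<open>(x0 / M) powr \<gamma>\<close>
    pays for; if x > x0 as well, the whole factor in front of \<open>\<psi> x\<close> is at most
    1.\<close>
  define C where "C = C0 * (x0 / M) powr \<gamma>"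
  have C0: "0 < C0" "C0 \<le> 1" using \<gamma> powr_mono[of "-\<gamma>" 0 2] by (auto simp: C0_def)
  have r1: "(x0 / M) powr \<gamma> \<le> 1" using x0 M \<gamma> powr_mono2[of \<gamma> "x0 / M" 1] by simp
  show ?thesis
  proof (rule that)
    show "C > 0" using C0 x0 M by (simp add: C_def)
    fix x y assume xy: "0 < x" "x \<le> y" "y \<le> M"
    consider "y \<le> x0" | "x \<le> x0" "x0 < y" | "x0 < x" by linarith
    hence "C * (y / x) powr \<gamma> * \<psi> x \<le> \<psi> y"
    proof cases
      case 1
      have "C * (y / x) powr \<gamma> * \<psi> x \<le> C0 * (y / x) powr \<gamma> * \<psi> x"
        using C0 r1 pos[OF xy(1)] unfolding C_def by (intro mult_right_mono mult_left_le) auto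
      also have "\<dots> \<le> \<psi> y" using small xy 1 by auto
      finally show ?thesis .
    next
      case 2
      have "C * (y / x) powr \<gamma> = C0 * (x0 / M * (y / x)) powr \<gamma>"
        using x0 M xy by (subst powr_mult) (auto simp: C_def)
      also have "\<dots> \<le> C0 * (x0 / x) powr \<gamma>"
        using x0 M xy C0 \<gamma> by (intro mult_left_mono powr_mono2) (auto simp: field_simps)
      finally have "C * (y / x) powr \<gamma> * \<psi> x \<le> C0 * (x0 / x) powr \<gamma> * \<psi> x"
        using pos[OF xy(1)] by (intro mult_right_mono) auto
      also have "\<dots> \<le> \<psi> x0" using small[of x x0] xy 2 by auto
      also have "\<dots> \<le> \<psi> y" using x0 2 by (intro mono_onD[OF mono]) auto
      finally show ?thesis .
    next
      case 3
      have "C * (y / x) powr \<gamma> = C0 * (x0 / M * (y / x)) powr \<gamma>"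
        using x0 M xy by (subst powr_mult) (auto simp: C_def)
      also have "\<dots> \<le> 1 * 1 powr \<gamma>"
      proof (intro mult_mono powr_mono2)
        have "x0 * y \<le> x * M" using x0 3 xy by (intro mult_mono) auto
        thus "x0 / M * (y / x) \<le> 1" using xy M by (simp add: field_simps)
      qed (use x0 M xy C0 \<gamma> in auto)
      finally have "C * (y / x) powr \<gamma> * \<psi> x \<le> 1 * \<psi> x"
        using pos[OF xy(1)] by (intro mult_right_mono) auto
      also have "\<psi> x \<le> \<psi> y" using xy by (intro mono_onD[OF mono]) auto
      finally show ?thesis by simp
    qed
    thus "C * (y / x) powr (\<beta> / 2) * \<psi> x \<le> \<psi> y" by (simp add: \<gamma>_def)
  qed
qed

subsection \<open>Volumes of ellipsoids\<close>

text \<open>The library states this (as \<open>measure_linear_image\<close>) only for well-ordered index types.\<close>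

lemma measure_linear_image_cart:
  fixes f :: "real ^ 'n::finite \<Rightarrow> real ^ 'n"
  assumes "linear f" "S \<in> lmeasurable"
  shows "f ` S \<in> lmeasurable \<and> measure lebesgue (f ` S) = \<bar>det (matrix f)\<bar> * measure lebesgue S"
proof -
  let ?P = "\<lambda>f :: real ^ 'n \<Rightarrow> real ^ 'n. \<forall>S\<in>lmeasurable. f ` S \<in> lmeasurable \<and>
              measure lebesgue (f ` S) = \<bar>det (matrix f)\<bar> * measure lebesgue S"
  \<comment> \<open>For a map whose determinant has modulus 1, invariance of the volumes of boxes
    suffices; the swap and the shear below are reduced to this.\<close>
  have boxes: "?P f"
    if "linear f" "\<bar>det (matrix f)\<bar> = 1" "\<And>a b. cbox a b \<noteq> {} \<Longrightarrow> measure lebesgue (f ` cbox a b) = measure lebesgue (cbox a b)" for f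
  proof
    fix S :: "(real ^ 'n) set" assume "S \<in> lmeasurable"
    moreover have "measure lebesgue (f ` cbox a b) = 1 * measure lebesgue (cbox a b)" for a b
      using that(3)[of a b] by (cases "cbox a b = {}") auto
    ultimately show "f ` S \<in> lmeasurable \<and> measure lebesgue (f ` S) = \<bar>det (matrix f)\<bar> * measure lebesgue S"
      using measure_linear_sufficient[of f S 1] that by simp
  qed
  have "?P f"
  proof (rule induct_linear_elementary[OF \<open>linear f\<close>])
    fix f g :: "real ^ 'n \<Rightarrow> real ^ 'n"
    assume "linear f" "linear g" and fg: "?P f" "?P g"
    hence "matrix (f \<circ> g) = matrix f ** matrix g" by (simp add: matrix_compose)
    moreover have "(f \<circ> g) ` S = f ` g ` S" for S by (simp add: image_comp)
    ultimately show "?P (f \<circ> g)" using fg by (simp add: det_mul abs_mult del: o_apply comp_apply)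
  next
    fix f :: "real ^ 'n \<Rightarrow> real ^ 'n" and i
    assume f: "linear f" and z: "\<And>x. f x $ i = 0"
    \<comment> \<open>The image lies in a coordinate hyperplane, so the map is singular and both
      sides of the formula are 0.\<close>
    have "\<not> surj f"
    proof
      assume "surj f"
      then obtain x where "f x = axis i 1" by (metis surjD)
      thus False using z[of x] by simp
    qed
    hence ninj: "\<not> inj f" using f linear_injective_imp_surjective by blast
    hence "det (matrix f) = 0" using det_nz_iff_inj[OF f] by blast
    moreover have "negligible (f ` S)" for S
      using negligible_linear_singular_image[OF f ninj] .
    ultimately show "?P f" by (auto simp: negligible_iff_measure)
  next
    fix c :: "'n \<Rightarrow> real"
    have "det (matrix (\<lambda>x. \<chi> i. c i * x $ i)) = prod c UNIV"
      by (subst det_diagonal) (auto simp: matrix_def axis_def)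
    thus "?P (\<lambda>x. \<chi> i. c i * x $ i)" by (simp add: measurable_stretch measure_stretch)
  next
    fix m n :: 'n
    define h :: "real ^ 'n \<Rightarrow> real ^ 'n" where "h x = (\<chi> i. x $ Transposition.transpose m n i)" for x
    assume "m \<noteq> n"
    show "?P (\<lambda>x. \<chi> i. x $ Transposition.transpose m n i)"
      unfolding h_def[symmetric, abs_def]
    proof (rule boxes)
      show "linear h" by (rule linearI) (simp_all add: h_def vec_eq_iff)
      have "matrix h = (\<chi> i. mat 1 $ Transposition.transpose m n i)"
        by (simp add: matrix_def h_def vec_eq_iff axis_def mat_def)
      hence "det (matrix h) = of_int (sign (Transposition.transpose m n)) * det (mat 1 :: real ^ 'n ^ 'n)"
        using det_permute_rows[OF permutes_swap_id[of m UNIV n], of "mat 1 :: real ^ 'n ^ 'n"] by simp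
      thus "\<bar>det (matrix h)\<bar> = 1" by (simp add: sign_def)
      fix a b :: "real ^ 'n" assume ne: "cbox a b \<noteq> {}"
      have hh: "h (h x) = x" for x by (simp add: h_def vec_eq_iff)
      have sub: "h ` cbox u v \<subseteq> cbox (h u) (h v)" for u v by (auto simp: mem_box_cart h_def)
      \<comment> \<open>\<open>h\<close> is an involution, so applying it to the inclusion for the
        image box gives the reverse inclusion.\<close>
      have eq: "h ` cbox a b = cbox (h a) (h b)"
        using sub[of a b] image_mono[OF sub[of "h a" "h b"], of h] by (auto simp: hh image_image)
      have "(\<Prod>i\<in>UNIV. h b $ i - h a $ i) = (\<Prod>i\<in>UNIV. b $ i - a $ i)"
        using prod.permute[OF permutes_swap_id[of m UNIV n], of "\<lambda>i. b $ i - a $ i"] by (simp add: h_def o_def)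
      moreover have "cbox (h a) (h b) \<noteq> {}" using eq ne by blast
      ultimately show "measure lebesgue (h ` cbox a b) = measure lebesgue (cbox a b)"
        using ne by (simp add: eq content_cbox_cart)
    qed
  next
    fix m n :: 'n
    define h :: "real ^ 'n \<Rightarrow> real ^ 'n" where "h x = (\<chi> i. if i = m then x $ m + x $ n else x $ i)" for x
    assume mn: "m \<noteq> n"
    have lin: "linear h" by (rule linearI) (simp_all add: h_def vec_eq_iff algebra_simps)
    show "?P (\<lambda>x. \<chi> i. if i = m then x $ m + x $ n else x $ i)"
      unfolding h_def[symmetric, abs_def]
    proof (rule boxes)
      show "linear h" by (fact lin)
      have "matrix h = (\<chi> k. if k = m then row m (mat 1) + 1 *s row n (mat 1) else row k (mat 1))"
        by (simp add: matrix_def h_def vec_eq_iff axis_def mat_def row_def)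
      thus "\<bar>det (matrix h)\<bar> = 1" using det_row_operation[OF mn, of "mat 1 :: real ^ 'n ^ 'n" 1] by simp
      fix a b :: "real ^ 'n" assume ne: "cbox a b \<noteq> {}"
      \<comment> \<open>The box is moved so that its lower corner is 0, where the volume formula for
        sheared boxes applies; linearity turns the translation by \<open>a\<close> into one by
        \<open>h a\<close>.\<close>
      have ab: "cbox a b = (+) a ` cbox 0 (b - a)" using cbox_translation[of a 0 "b - a"] by simp
      hence ne': "cbox 0 (b - a) \<noteq> {}" using ne by auto
      have "h ` cbox a b = (+) (h a) ` h ` cbox 0 (b - a)"
        by (simp add: ab image_image linear_add[OF lin])
      hence "measure lebesgue (h ` cbox a b) = measure lebesgue (h ` cbox 0 (b - a))"
        by (simp add: measure_translation)
      also have "\<dots> = measure lebesgue (cbox 0 (b - a))"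
        using measure_shear_interval[OF mn ne'] by (simp add: h_def[abs_def])
      also have "\<dots> = measure lebesgue (cbox a b)" by (simp add: ab measure_translation del: measure_completion)
      finally show "measure lebesgue (h ` cbox a b) = measure lebesgue (cbox a b)" .
    qed
  qed
  with assms show ?thesis by blast
qed

text \<open>Gram-Schmidt for the inner product given by Q: while fewer than CARD('n) vectors are
  chosen, some vector lies outside their span. The columns of \<open>E\<close> are the resulting
  basis. \<open>E\<close> plays the role of Q^(-1/2) without an appeal to the spectral
  theorem.\<close>

lemma quadratic_form_orthonormal_basis:
  fixes Q :: "real ^ 'n::finite ^ 'n"
  assumes sym: "transpose Q = Q" and pos: "\<And>u. u \<noteq> 0 \<Longrightarrow> (Q *v u) \<bullet> u > 0"
  obtains E :: "real ^ 'n ^ 'n" where "transpose E ** Q ** E = mat 1"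
proof -
  define B where "B x y = (Q *v x) \<bullet> y" for x y :: "real ^ 'n"
  have Bsym: "B x y = B y x" for x y
    unfolding B_def using sym by (metis dot_lmul_matrix inner_commute transpose_matrix_vector)
  have Bdiff: "B (x - y) z = B x z - B y z" for x y z
    by (simp add: B_def matrix_vector_mult_diff_distrib inner_diff_left)
  have Bsum: "B (\<Sum>i\<in>S. f i *\<^sub>R i) z = (\<Sum>i\<in>S. f i * B i z)" for S f z
    by (induction S rule: infinite_finite_induct)
       (simp_all add: B_def matrix_vector_right_distrib inner_add_left scaleR_matrix_vector_assoc[symmetric]
          matrix_vector_mult_scaleR)
  have Bscale: "B (c *\<^sub>R x) z = c * B x z" for c x z
    by (simp add: B_def matrix_vector_mult_scaleR)
  define ON where "ON S \<longleftrightarrow> finite S \<and> (\<forall>x\<in>S. \<forall>y\<in>S. B x y = of_bool (x = y))" for S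
  have "\<exists>S. ON S \<and> card S = k" if "k \<le> CARD('n)" for k
    using that
  proof (induction k)
    case 0
    then show ?case by (intro exI[of _ "{}"]) (auto simp: ON_def)
  next
    case (Suc k)
    then obtain S where S: "ON S" "card S = k" by auto
    have fin: "finite S" using S by (simp add: ON_def)
    have "dim (span S) \<le> k" using dim_le_card'[OF fin] S by (simp add: dim_span)
    hence "span S \<noteq> UNIV" using Suc.prems dim_span[of S] by (auto simp del: dim_span)
    then obtain x where x: "x \<notin> span S" by auto
    define x' where "x' = x - (\<Sum>b\<in>S. B x b *\<^sub>R b)"
    have "x' \<noteq> 0"
    proof
      assume "x' = 0"
      hence "x = (\<Sum>b\<in>S. B x b *\<^sub>R b)" by (simp add: x'_def)
      also have "\<dots> \<in> span S" by (intro span_sum span_scale span_base)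
      finally show False using x by simp
    qed
    hence p: "B x' x' > 0" using pos by (simp add: B_def)
    have orth: "B x' c = 0" if "c \<in> S" for c
    proof -
      have "(\<Sum>b\<in>S. B x b * B b c) = (\<Sum>b\<in>S. if b = c then B x b else 0)"
        using S that by (intro sum.cong) (auto simp: ON_def)
      thus ?thesis using that fin by (simp add: x'_def Bdiff Bsum)
    qed
    define y where "y = (1 / sqrt (B x' x')) *\<^sub>R x'"
    have yc: "B y c = 0" if "c \<in> S" for c using orth[OF that] by (simp add: y_def Bscale)
    have cy: "B c y = 0" if "c \<in> S" for c using yc[OF that] Bsym[of c y] by simp
    have yy: "B y y = 1"
      using p Bsym[of x' "(1 / sqrt (B x' x')) *\<^sub>R x'"] by (simp add: y_def Bscale)
    have "y \<notin> S" using yc yy by force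
    moreover have "ON (insert y S)"
      using S yc cy yy \<open>y \<notin> S\<close> unfolding ON_def by auto
    ultimately show ?case using S fin by (intro exI[of _ "insert y S"]) auto
  qed
  then obtain S where S: "ON S" "card S = CARD('n)" by blast
  hence "finite S" by (simp add: ON_def)
  then obtain g where g: "bij_betw g (UNIV :: 'n set) S"
    using S by (metis finite_same_card_bij finite_class.finite_UNIV)
  define E :: "real ^ 'n ^ 'n" where "E = (\<chi> i j. g j $ i)"
  have "(transpose E ** Q ** E) $ i $ j = B (g i) (g j)" for i j
  proof -
    have "(transpose E ** Q ** E) $ i $ j = (\<Sum>k\<in>UNIV. (\<Sum>l\<in>UNIV. g i $ l * Q $ l $ k) * g j $ k)"
      by (simp add: E_def matrix_matrix_mult_def transpose_def)
    also have "\<dots> = (g i v* Q) \<bullet> g j"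
      by (simp add: inner_vec_def vector_matrix_mult_def mult.commute)
    also have "\<dots> = B (g j) (g i)" by (metis B_def dot_lmul_matrix inner_commute)
    finally show ?thesis using Bsym by simp
  qed
  moreover have "B (g i) (g j) = (if i = j then 1 else 0)" for i j
    using S(1) g unfolding ON_def bij_betw_def inj_on_def by (auto dest: injD)
  ultimately have "transpose E ** Q ** E = mat 1" by (simp add: vec_eq_iff mat_def)
  thus ?thesis using that by blast
qed

text \<open>With \<open>E\<close> from the previous lemma, \<open>w \<mapsto> E *v w\<close> pulls
  the quadratic form back to \<open>w \<bullet> w\<close>, so the ellipsoid is the image of the ball
  of radius r. Taking determinants in the defining identity of \<open>E\<close> gives the modulus of
  \<open>det E\<close>.\<close>

lemma ellipsoid_measure:
  fixes Q :: "real ^ 'n::finite ^ 'n"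
  assumes sym: "transpose Q = Q" and pos: "\<And>u. u \<noteq> 0 \<Longrightarrow> (Q *v u) \<bullet> u > 0" and r: "r \<ge> 0"
  shows "det Q > 0"
    and "emeasure lborel {u. (Q *v u) \<bullet> u \<le> r\<^sup>2} =
           ennreal (det Q powr (- (1/2)) * unit_ball_vol (CARD('n)) * r ^ CARD('n))"
proof -
  obtain E :: "real ^ 'n ^ 'n" where E: "transpose E ** Q ** E = mat 1"
    by (rule quadratic_form_orthonormal_basis[OF sym pos])
  hence "det (transpose E ** Q ** E) = 1" by simp
  hence d: "det Q * (det E)\<^sup>2 = 1" by (simp add: det_mul power2_eq_square mult_ac)
  have dE: "det E \<noteq> 0" using d by auto
  have "det Q = 1 / (det E)\<^sup>2" using d dE by (simp add: field_simps)
  thus dQ: "det Q > 0" using dE by simp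
  have absE: "\<bar>det E\<bar> = det Q powr (- (1/2))"
  proof -
    have "det Q powr (- (1/2)) = 1 / sqrt (det Q)"
      using dQ by (simp add: powr_minus powr_half_sqrt field_simps)
    also have "sqrt (det Q) = 1 / \<bar>det E\<bar>"
      using \<open>det Q = _\<close> by (simp add: real_sqrt_divide)
    finally show ?thesis by simp
  qed
  have "invertible E" using dE by (simp add: invertible_det_nz)
  then obtain E' where E': "E ** E' = mat 1" unfolding invertible_def by blast
  have quad: "(Q *v (E *v w)) \<bullet> (E *v w) = w \<bullet> w" for w
  proof -
    have "(Q *v (E *v w)) \<bullet> (E *v w) = (transpose E *v (Q *v (E *v w))) \<bullet> w"
      by (metis dot_lmul_matrix inner_commute transpose_matrix_vector)
    also have "transpose E *v (Q *v (E *v w)) = w"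
      using E by (simp add: matrix_vector_mul_assoc matrix_mul_assoc)
    finally show ?thesis .
  qed
  have img: "{u. (Q *v u) \<bullet> u \<le> r\<^sup>2} = (\<lambda>w. E *v w) ` cball 0 r"
  proof (intro equalityI subsetI)
    fix u assume u: "u \<in> {u. (Q *v u) \<bullet> u \<le> r\<^sup>2}"
    define w where "w = E' *v u"
    have "u = E *v w" using E' by (simp add: w_def matrix_vector_mul_assoc)
    moreover from this u quad[of w] have "norm w \<le> r"
      using r by (simp add: dot_square_norm power2_le_iff_abs_le)
    ultimately show "u \<in> (\<lambda>w. E *v w) ` cball 0 r" by auto
  next
    fix u assume "u \<in> (\<lambda>w. E *v w) ` cball 0 r"
    then show "u \<in> {u. (Q *v u) \<bullet> u \<le> r\<^sup>2}"
      using r by (auto simp: quad dot_square_norm)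
  qed
  have lm: "cball (0::real^'n) r \<in> lmeasurable" by simp
  have [measurable]: "(\<lambda>u. Q *v u) \<in> borel_measurable borel"
    by (intro borel_measurable_continuous_onI linear_continuous_on)
       (simp add: matrix_vector_mul_bounded_linear)
  have mb: "{u. (Q *v u) \<bullet> u \<le> r\<^sup>2} \<in> sets borel" by measurable
  have lin: "linear (\<lambda>w. E *v w)" by (rule matrix_vector_mul_linear)
  have "emeasure lborel {u. (Q *v u) \<bullet> u \<le> r\<^sup>2} = emeasure lebesgue ((\<lambda>w. E *v w) ` cball 0 r)"
    using mb by (simp add: img)
  also have "\<dots> = ennreal (measure lebesgue ((\<lambda>w. E *v w) ` cball 0 r))"
    using measure_linear_image_cart[OF lin lm, THEN conjunct1] by (rule emeasure_eq_measure2)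
  also have "measure lebesgue ((\<lambda>w. E *v w) ` cball 0 r) = \<bar>det E\<bar> * measure lebesgue (cball (0::real^'n) r)"
    by (subst measure_linear_image_cart[OF lin lm, THEN conjunct2]) simp
  also have "measure lebesgue (cball (0::real^'n) r) = unit_ball_vol (CARD('n)) * r ^ CARD('n)"
    using content_cball[OF r, of "0::real^'n"] by simp
  finally show "emeasure lborel {u. (Q *v u) \<bullet> u \<le> r\<^sup>2} =
           ennreal (det Q powr (- (1/2)) * unit_ball_vol (CARD('n)) * r ^ CARD('n))"
    by (simp add: absE mult_ac)
qed

text \<open>The sublevel set at height t is the ellipsoid with r^2 = 2 t^(1/\<beta>), whose volume
  is proportional to t^(d/(2\<beta>)); integrated against exp(-t) this gives the first Gamma value.
  The unit ball contributes pi^(d/2) and the second Gamma value, and 2^(d/2) comes from the division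
  by 2 in the exponent.\<close>

lemma nn_integral_exp_quadratic_powr:
  fixes Q :: "real ^ 'n::finite ^ 'n"
  assumes sym: "transpose Q = Q" and pos: "\<And>u. u \<noteq> 0 \<Longrightarrow> (Q *v u) \<bullet> u > 0" and \<beta>: "\<beta> > 0"
  shows "(\<integral>\<^sup>+u. ennreal (exp (- (((Q *v u) \<bullet> u / 2) powr \<beta>))) \<partial>lborel) =
           ennreal ((2 * pi) powr (CARD('n) / 2) *
             (Gamma (1 + CARD('n) / (2 * \<beta>)) / Gamma (1 + CARD('n) / 2)) * det Q powr (- (1/2)))"
proof -
  let ?d = "real CARD('n)"
  have G: "0 < 1 + ?d / (2 * \<beta>)" using \<beta> by (intro add_pos_nonneg) auto
  define g where "g u = ((Q *v u) \<bullet> u / 2) powr \<beta>" for u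
  have [measurable]: "(\<lambda>u. Q *v u) \<in> borel_measurable borel"
    by (intro borel_measurable_continuous_onI linear_continuous_on)
       (simp add: matrix_vector_mul_bounded_linear)
  have gm [measurable]: "g \<in> borel_measurable borel" unfolding g_def by measurable
  have Q0: "(Q *v u) \<bullet> u \<ge> 0" for u using pos[of u] by (cases "u = 0") auto
  \<comment> \<open>Layer cake: integrate the volumes of the ellipsoids \<open>g u \<le> t\<close> against \<open>exp (- t)\<close>.\<close>
  have e: "ennreal (exp (- s)) = (\<integral>\<^sup>+t. ennreal (indicator {s..} t * exp (- t)) \<partial>lborel)" for s :: real
  proof -
    have "((\<lambda>t::real. - exp (- t)) \<longlongrightarrow> - 0) at_top"
      by (intro tendsto_minus filterlim_compose[OF exp_at_bot filterlim_uminus_at_bot_at_top])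
    hence "(\<integral>\<^sup>+t. ennreal (exp (- t)) * indicator {s..} t \<partial>lborel) = ennreal (0 - (- exp (- s)))"
      by (intro nn_integral_FTC_atLeast) (auto intro!: derivative_eq_intros)
    thus ?thesis by (simp add: nn_integral_set_ennreal mult.commute)
  qed
  have "(\<integral>\<^sup>+u. ennreal (exp (- g u)) \<partial>lborel) =
      (\<integral>\<^sup>+u. \<integral>\<^sup>+t. ennreal (indicator {g u..} t * exp (- t)) \<partial>lborel \<partial>lborel)"
    by (simp only: e)
  also have "\<dots> = (\<integral>\<^sup>+t. \<integral>\<^sup>+u. ennreal (indicator {g u..} t * exp (- t)) \<partial>lborel \<partial>lborel)"
  proof (rule lborel_pair.Fubini'[symmetric])
    have "Measurable.pred (borel \<Otimes>\<^sub>M borel) (\<lambda>(u, t). t \<in> {g u..})" by simp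
    hence "(\<lambda>(u, t). ennreal ((if t \<in> {g u..} then 1 else 0) * exp (- t))) \<in> borel_measurable (borel \<Otimes>\<^sub>M borel)"
      by measurable
    thus "(\<lambda>(u, t). ennreal (indicator {g u..} t * exp (- t))) \<in> borel_measurable (lborel \<Otimes>\<^sub>M lborel)"
      by (simp add: indicator_def[abs_def] of_bool_def[abs_def] cong: measurable_cong_sets)
  qed
  also have "\<dots> = (\<integral>\<^sup>+t. ennreal (det Q powr (- (1/2)) * unit_ball_vol ?d * 2 powr (?d / 2)) *
      ennreal (indicator {0..} t * t powr ((1 + ?d / (2 * \<beta>)) - 1) / exp t) \<partial>lborel)"
  proof (rule nn_integral_cong_AE)
    \<comment> \<open>Discarding the null set t = 0 leaves t < 0, where the sublevel set is empty,
      and t > 0, where it is a genuine ellipsoid.\<close>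
    have "AE t::real in lborel. t \<noteq> 0" by (rule AE_lborel_singleton)
    thus "AE t in lborel. (\<integral>\<^sup>+u. ennreal (indicator {g u..} t * exp (- t)) \<partial>lborel) =
      ennreal (det Q powr (- (1/2)) * unit_ball_vol ?d * 2 powr (?d / 2)) *
      ennreal (indicator {0..} t * t powr ((1 + ?d / (2 * \<beta>)) - 1) / exp t)"
    proof eventually_elim
      case (elim t)
      have "(\<integral>\<^sup>+u. ennreal (indicator {g u..} t * exp (- t)) \<partial>lborel) =
          (\<integral>\<^sup>+u. ennreal (exp (- t)) * indicator {u. g u \<le> t} u \<partial>lborel)"
        by (intro nn_integral_cong) (auto split: split_indicator)
      also have "\<dots> = ennreal (exp (- t)) * emeasure lborel {u. g u \<le> t}"
        by (intro nn_integral_cmult_indicator) simp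
      finally have 1: "(\<integral>\<^sup>+u. ennreal (indicator {g u..} t * exp (- t)) \<partial>lborel) =
        ennreal (exp (- t)) * emeasure lborel {u. g u \<le> t}" .
      show ?case
      proof (cases "t > 0")
        case False
        have "\<not> g u \<le> t" for u
        proof -
          have "0 \<le> g u" by (simp add: g_def)
          thus ?thesis using False elim by linarith
        qed
        hence "{u. g u \<le> t} = {}" by simp
        thus ?thesis using 1 False elim by simp
      next
        case True
        define r where "r = sqrt (2 * t powr (1 / \<beta>))"
        have r: "r \<ge> 0" by (simp add: r_def)
        have "g u \<le> t \<longleftrightarrow> (Q *v u) \<bullet> u \<le> r\<^sup>2" for u
        proof -
          have "g u \<le> t \<longleftrightarrow> g u powr (1 / \<beta>) \<le> t powr (1 / \<beta>)"
            using True \<beta> powr_mono2[of "1/\<beta>" "g u" t] powr_less_mono2[of "1/\<beta>" t "g u"]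
            by (auto simp: g_def not_le[symmetric])
          also have "g u powr (1 / \<beta>) = (Q *v u) \<bullet> u / 2"
            using \<beta> Q0[of u] by (simp add: g_def powr_powr)
          finally show ?thesis by (simp add: r_def mult.commute)
        qed
        hence "emeasure lborel {u. g u \<le> t} =
            ennreal (det Q powr (- (1/2)) * unit_ball_vol ?d * r ^ CARD('n))"
          using ellipsoid_measure(2)[OF sym pos r] by simp
        moreover have "r ^ CARD('n) = 2 powr (?d / 2) * t powr (?d / (2 * \<beta>))"
        proof -
          have "r > 0" using True by (simp add: r_def)
          hence "r ^ CARD('n) = r powr ?d" by (simp add: powr_realpow)
          moreover have "r = (2 * t powr (1 / \<beta>)) powr (1/2)" by (simp add: r_def powr_half_sqrt)
          ultimately show ?thesis by (simp add: powr_powr powr_mult mult.commute)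
        qed
        ultimately show ?thesis using 1 True
          by (simp add: ennreal_mult'[symmetric] exp_minus field_simps)
      qed
    qed
  qed
  also have "\<dots> = ennreal (det Q powr (- (1/2)) * unit_ball_vol ?d * 2 powr (?d / 2)) *
       ennreal (Gamma (1 + ?d / (2 * \<beta>)))"
    by (subst nn_integral_cmult, simp, subst Gamma_conv_nn_integral_real) (use G in auto)
  also have "\<dots> = ennreal (det Q powr (- (1/2)) * unit_ball_vol ?d * 2 powr (?d / 2) * Gamma (1 + ?d / (2 * \<beta>)))"
    by (intro ennreal_mult[symmetric]) (use G in \<open>auto intro!: Gamma_real_nonneg\<close>)
  also have "det Q powr (- (1/2)) * unit_ball_vol ?d * 2 powr (?d / 2) * Gamma (1 + ?d / (2 * \<beta>)) =
      (2 * pi) powr (?d / 2) * (Gamma (1 + ?d / (2 * \<beta>)) / Gamma (1 + ?d / 2)) * det Q powr (- (1/2))"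
    by (simp add: unit_ball_vol_def powr_mult add.commute)
  finally show ?thesis by (simp add: g_def)
qed

subsection \<open>Bernstein functions on the right half-plane\<close>

text \<open>For w = s z the two bounds together give a multiple of \<open>min 1 s\<close>, the
  function that \<nu> is known to integrate. The first splits exp(-w) into modulus and phase and
  bounds the two defects separately.\<close>

lemma norm_one_minus_exp_le:
  fixes w :: complex
  assumes "Re w \<ge> 0"
  shows "norm (1 - exp (- w)) \<le> 2 * norm w" "norm (1 - exp (- w)) \<le> 2"
proof -
  have ex: "exp (- w) = of_real (exp (- Re w)) * iexp (- Im w)"
  proof -
    have "- w = of_real (- Re w) + \<i> * of_real (- Im w)" by (simp add: complex_eq_iff)
    thus ?thesis by (simp only: exp_add exp_of_real)
  qed
  have 1: "norm (iexp (- Im w) - 1) \<le> \<bar>Im w\<bar>"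
    using iexp_approx1[of "- Im w" 0] by simp
  have "1 - exp (- w) = of_real (1 - exp (- Re w)) - of_real (exp (- Re w)) * (iexp (- Im w) - 1)"
    by (simp add: ex algebra_simps)
  also have "norm \<dots> \<le> norm (complex_of_real (1 - exp (- Re w))) + norm (of_real (exp (- Re w)) * (iexp (- Im w) - 1))"
    by (rule norm_triangle_ineq4)
  also have "\<dots> = (1 - exp (- Re w)) + exp (- Re w) * norm (iexp (- Im w) - 1)"
    using assms by (simp only: norm_mult norm_of_real) simp
  also have "\<dots> \<le> Re w + 1 * \<bar>Im w\<bar>"
    using exp_ge_add_one_self[of "- Re w"] assms 1 by (intro add_mono mult_mono) auto
  also have "\<dots> \<le> 2 * norm w"
    using abs_Re_le_cmod[of w] abs_Im_le_cmod[of w] by linarith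
  finally show "norm (1 - exp (- w)) \<le> 2 * norm w" .
  have "norm (1 - exp (- w)) \<le> norm (1 :: complex) + norm (exp (- w))" by (rule norm_triangle_ineq4)
  also have "norm (exp (- w)) \<le> 1" using assms by (simp add: norm_exp_eq_Re)
  finally show "norm (1 - exp (- w)) \<le> 2" by simp
qed

text \<open>Monotonicity, positivity and the extension of \<psi> to complex arguments are all drawn
  from the integral representation, which is therefore fixed here together with the
  normalization.\<close>

locale bernstein_laplace =
  fixes \<psi> :: "real \<Rightarrow> real" and a b :: real and \<nu> :: "real measure"
  assumes repr: "bernstein_repr \<psi> a b \<nu>" and psi_0: "\<psi> 0 = 0" and psi_1: "\<psi> 1 = 1"
begin

lemma a_eq_0: "a = 0"
  using repr psi_0 by (auto simp: bernstein_repr_def)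

lemma b_nonneg: "b \<ge> 0"
  using repr by (simp add: bernstein_repr_def)

lemma sets_nu [measurable_cong]: "sets \<nu> = sets (restrict_space borel {0..})"
  using repr by (simp add: bernstein_repr_def)

lemma space_nu: "space \<nu> = {0..}"
  using sets_eq_imp_space_eq[OF sets_nu] by (simp add: space_restrict_space)

lemma psi_eq: "x \<ge> 0 \<Longrightarrow> \<psi> x = b * x + (\<integral>s. (1 - exp (- (x * s))) \<partial>\<nu>)"
  using repr a_eq_0 by (auto simp: bernstein_repr_def)

lemma borel_measurable_nu: "f \<in> borel_measurable borel \<Longrightarrow> f \<in> borel_measurable \<nu>"
  using measurable_cong_sets[OF sets_nu refl] by (auto intro: measurable_restrict_space1)

lemma AE_nu_I: "(\<And>s. s \<ge> 0 \<Longrightarrow> P s) \<Longrightarrow> AE s in \<nu>. P s"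
  using space_nu by (auto intro!: AE_I2)

lemma integrable_min: "integrable \<nu> (\<lambda>s. min 1 s)"
proof (rule integrableI_nonneg)
  show "(\<lambda>s. min 1 s) \<in> borel_measurable \<nu>" by (rule borel_measurable_nu) simp
  show "(\<integral>\<^sup>+ s. ennreal (min 1 s) \<partial>\<nu>) < \<infinity>" using repr by (simp add: bernstein_repr_def)
qed (auto intro!: AE_nu_I)

text \<open>The measure \<nu> may have infinite mass near 0, even an infinite atom at 0, so
  constants need not be integrable and bounds have to be multiples of
  \<open>min 1 s\<close>.\<close>

lemma integrable_nuI:
  fixes f :: "real \<Rightarrow> 'c::{banach, second_countable_topology}"
  assumes "f \<in> borel_measurable borel" and le: "\<And>s. s \<ge> 0 \<Longrightarrow> norm (f s) \<le> C * min 1 s"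
  shows "integrable \<nu> f"
proof (rule Bochner_Integration.integrable_bound)
  show "integrable \<nu> (\<lambda>s. C * min 1 s)" using integrable_min by simp
  show "f \<in> borel_measurable \<nu>" using assms(1) by (rule borel_measurable_nu)
  show "AE s in \<nu>. norm (f s) \<le> norm (C * min 1 s)"
    by (rule AE_nu_I) (use le in \<open>force intro: order_trans\<close>)
qed

lemma integrable_one_minus_exp_complex:
  assumes "Re z \<ge> 0"
  shows "integrable \<nu> (\<lambda>s. 1 - exp (- (of_real s * z)))"
proof (rule integrable_nuI)
  show "(\<lambda>s. 1 - exp (- (of_real s * z))) \<in> borel_measurable borel"
    by (intro borel_measurable_continuous_onI continuous_intros)
  fix s :: real assume s: "s \<ge> 0"
  have r: "Re (of_real s * z) \<ge> 0" using s assms by simp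
  have "norm (1 - exp (- (of_real s * z))) \<le> 2 * (s * norm z)"
    using norm_one_minus_exp_le(1)[OF r] s by (simp add: norm_mult)
  moreover have "norm (1 - exp (- (of_real s * z))) \<le> 2" by (rule norm_one_minus_exp_le(2)[OF r])
  moreover have "norm z \<ge> 0" by simp
  ultimately show "norm (1 - exp (- (of_real s * z))) \<le> (2 + 2 * norm z) * min 1 s"
  proof (cases "s \<le> 1")
    case True
    have "(2 + 2 * norm z) * min 1 s = 2 * s + 2 * (s * norm z)" using True by (simp add: min_def algebra_simps)
    thus ?thesis using \<open>norm (1 - exp (- (of_real s * z))) \<le> 2 * (s * norm z)\<close> s by linarith
  next
    case False
    have "(2 + 2 * norm z) * min 1 s = 2 + 2 * norm z" using False by (simp add: min_def)
    thus ?thesis using \<open>norm (1 - exp (- (of_real s * z))) \<le> 2\<close> \<open>norm z \<ge> 0\<close> by linarith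
  qed
qed

lemma integrable_one_minus_exp:
  assumes "x \<ge> 0"
  shows "integrable \<nu> (\<lambda>s. 1 - exp (- (x * s)))"
proof -
  have "integrable \<nu> (\<lambda>s. Re (1 - exp (- (of_real s * of_real x))))"
    by (intro integrable_Re integrable_one_minus_exp_complex) (use assms in simp)
  also have "(\<lambda>s. Re (1 - exp (- (of_real s * of_real x)))) = (\<lambda>s. 1 - exp (- (x * s)))"
    by (simp add: fun_eq_iff exp_eq_polar mult.commute)
  finally show ?thesis .
qed

text \<open>The extension of \<psi> to the closed right half-plane; there is no constant term
  because \<open>a = 0\<close>. For Re z < 0 the integral may be the default value of a
  non-integrable function, so every use keeps Re z >= 0.\<close>

definition Psi :: "complex \<Rightarrow> complex" where
  "Psi z = of_real b * z + (\<integral>s. (1 - exp (- (of_real s * z))) \<partial>\<nu>)"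

lemma Psi_of_real: "x \<ge> 0 \<Longrightarrow> Psi (of_real x) = of_real (\<psi> x)"
proof -
  assume x: "x \<ge> 0"
  have "(\<integral>s. (1 - exp (- (of_real s * complex_of_real x))) \<partial>\<nu>)
      = (\<integral>s. complex_of_real (1 - exp (- (x * s))) \<partial>\<nu>)"
    by (intro Bochner_Integration.integral_cong) (simp_all add: exp_of_real[symmetric] mult.commute)
  also have "\<dots> = of_real (\<integral>s. (1 - exp (- (x * s))) \<partial>\<nu>)"
    by (rule integral_of_real[OF integrable_one_minus_exp[OF x]])
  finally show ?thesis by (simp add: Psi_def psi_eq[OF x])
qed

text \<open>The integrands differ by at most s |y| exp(-xs), and t exp(-t) <= 1 - exp(-t) with t =
  xs bounds this by |y| / x times the integrand of \<open>\<psi> x\<close>. The drift part satisfies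
  the same relative bound with equality.\<close>

lemma norm_Psi_diff_le:
  assumes "x > 0"
  shows "norm (Psi (Complex x y) - of_real (\<psi> x)) \<le> \<bar>y\<bar> / x * \<psi> x"
proof -
  let ?z = "Complex x y"
  have "Psi ?z - of_real (\<psi> x) = Psi ?z - Psi (of_real x)" using assms Psi_of_real[of x] by simp
  also have "\<dots> = of_real b * (?z - of_real x) +
      ((\<integral>s. (1 - exp (- (of_real s * ?z))) \<partial>\<nu>) - (\<integral>s. (1 - exp (- (of_real s * of_real x))) \<partial>\<nu>))"
    by (simp add: Psi_def algebra_simps)
  also have "(\<integral>s. (1 - exp (- (of_real s * ?z))) \<partial>\<nu>) - (\<integral>s. (1 - exp (- (of_real s * of_real x))) \<partial>\<nu>)
      = (\<integral>s. ((1 - exp (- (of_real s * ?z))) - (1 - exp (- (of_real s * of_real x)))) \<partial>\<nu>)"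
    by (rule Bochner_Integration.integral_diff[symmetric])
       (use assms in \<open>auto intro: integrable_one_minus_exp_complex\<close>)
  finally have eq: "Psi ?z - of_real (\<psi> x) = of_real b * (?z - of_real x) +
     (\<integral>s. ((1 - exp (- (of_real s * ?z))) - (1 - exp (- (of_real s * of_real x)))) \<partial>\<nu>)" .
  have int: "integrable \<nu> (\<lambda>s. \<bar>y\<bar> / x * (1 - exp (- (x * s))))"
    using integrable_one_minus_exp[of x] assms by simp
  have "norm (\<integral>s. ((1 - exp (- (of_real s * ?z))) - (1 - exp (- (of_real s * of_real x)))) \<partial>\<nu>)
      \<le> (\<integral>s. \<bar>y\<bar> / x * (1 - exp (- (x * s))) \<partial>\<nu>)"
  proof (rule Bochner_Integration.integral_norm_bound_integral[OF _ int])
    show "integrable \<nu> (\<lambda>s. (1 - exp (- (of_real s * ?z))) - (1 - exp (- (of_real s * of_real x))))"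
      by (intro Bochner_Integration.integrable_diff integrable_one_minus_exp_complex) (use assms in auto)
    fix s assume "s \<in> space \<nu>"
    hence s: "s \<ge> 0" by (simp add: space_nu)
    have "exp (- (of_real s * ?z)) = of_real (exp (- (x * s))) * iexp (- (s * y))"
    proof -
      have "- (of_real s * ?z) = of_real (- (x * s)) + \<i> * of_real (- (s * y))" by (simp add: complex_eq_iff)
      thus ?thesis by (simp only: exp_add exp_of_real)
    qed
    moreover have "exp (- (of_real s * complex_of_real x)) = of_real (exp (- (x * s)))"
      by (simp add: exp_of_real[symmetric] mult.commute)
    ultimately have "(1 - exp (- (of_real s * ?z))) - (1 - exp (- (of_real s * of_real x)))
       = - (of_real (exp (- (x * s))) * (iexp (- (s * y)) - 1))"
      by (simp add: algebra_simps)
    hence "norm ((1 - exp (- (of_real s * ?z))) - (1 - exp (- (of_real s * of_real x))))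
       = exp (- (x * s)) * norm (iexp (- (s * y)) - 1)"
      by (simp only: norm_minus_cancel norm_mult norm_of_real) simp
    also have "\<dots> \<le> exp (- (x * s)) * (s * \<bar>y\<bar>)"
      using iexp_approx1[of "- (s * y)" 0] s by (intro mult_left_mono) (auto simp: abs_mult)
    also have "\<dots> = \<bar>y\<bar> / x * (x * s * exp (- (x * s)))" using assms by simp
    also have "\<dots> \<le> \<bar>y\<bar> / x * (1 - exp (- (x * s)))"
    proof (rule mult_left_mono)
      have "(1 + x * s) * exp (- (x * s)) \<le> exp (x * s) * exp (- (x * s))"
        using exp_ge_add_one_self[of "x * s"] by (intro mult_right_mono) auto
      thus "x * s * exp (- (x * s)) \<le> 1 - exp (- (x * s))" by (simp add: exp_minus_inverse algebra_simps)
    qed (use assms in auto)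
    finally show "norm ((1 - exp (- (of_real s * ?z))) - (1 - exp (- (of_real s * of_real x))))
      \<le> \<bar>y\<bar> / x * (1 - exp (- (x * s)))" .
  qed
  also have "\<dots> = \<bar>y\<bar> / x * (\<integral>s. (1 - exp (- (x * s))) \<partial>\<nu>)" by simp
  finally have 1: "norm (\<integral>s. ((1 - exp (- (of_real s * ?z))) - (1 - exp (- (of_real s * of_real x)))) \<partial>\<nu>)
    \<le> \<bar>y\<bar> / x * (\<integral>s. (1 - exp (- (x * s))) \<partial>\<nu>)" .
  have "?z - of_real x = \<i> * of_real y" by (simp add: complex_eq_iff)
  hence 2: "norm (of_real b * (?z - of_real x)) = \<bar>y\<bar> / x * (b * x)"
    using b_nonneg assms by (simp add: norm_mult)
  have "norm (Psi ?z - of_real (\<psi> x)) \<le> \<bar>y\<bar> / x * (b * x) + \<bar>y\<bar> / x * (\<integral>s. (1 - exp (- (x * s))) \<partial>\<nu>)"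
    unfolding eq by (rule order_trans[OF norm_triangle_ineq]) (use 1 2 in linarith)
  also have "\<dots> = \<bar>y\<bar> / x * \<psi> x" by (simp only: psi_eq[OF less_imp_le[OF assms]] distrib_left)
  finally show ?thesis .
qed

text \<open>An atom of \<nu> at 0 contributes nothing to the integral, so this isolates the
  degenerate case of pure drift, which the proof of the theorem rules out.\<close>

lemma AE_nu_zero_imp_linear:
  assumes "AE s in \<nu>. s = 0" "x \<ge> 0"
  shows "\<psi> x = b * x"
proof -
  have "(\<integral>s. (1 - exp (- (x * s))) \<partial>\<nu>) = (\<integral>s. 0 \<partial>\<nu>)"
    by (rule integral_cong_AE) (use assms in \<open>auto intro: borel_measurable_nu elim: eventually_mono\<close>)
  thus ?thesis using psi_eq[OF assms(2)] by simp
qed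

text \<open>Two equal values of \<psi> would force b = 0 and \<nu> to live on {0}, hence \<psi> to
  vanish at 1. Strictness makes the inverse function of the theorem meaningful.\<close>

lemma strict_mono_psi: "strict_mono_on {0..} \<psi>"
proof (rule strict_mono_onI)
  fix x y :: real assume "x \<in> {0..}" "y \<in> {0..}" and xy: "x < y"
  hence x: "x \<ge> 0" and y: "y \<ge> 0" by auto
  have int: "integrable \<nu> (\<lambda>s. (1 - exp (- (y * s))) - (1 - exp (- (x * s))))"
    by (intro Bochner_Integration.integrable_diff integrable_one_minus_exp x y)
  have ae: "AE s in \<nu>. 0 \<le> (1 - exp (- (y * s))) - (1 - exp (- (x * s)))"
    by (rule AE_nu_I) (use xy in \<open>simp add: mult_right_mono\<close>)
  have eq: "\<psi> y - \<psi> x = b * (y - x) + (\<integral>s. ((1 - exp (- (y * s))) - (1 - exp (- (x * s)))) \<partial>\<nu>)"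
    unfolding psi_eq[OF x] psi_eq[OF y] right_diff_distrib
      Bochner_Integration.integral_diff[OF integrable_one_minus_exp[OF y] integrable_one_minus_exp[OF x]]
    by linarith
  have nn: "(\<integral>s. ((1 - exp (- (y * s))) - (1 - exp (- (x * s)))) \<partial>\<nu>) \<ge> 0"
    by (rule integral_nonneg_AE[OF ae])
  have bn: "b * (y - x) \<ge> 0" using b_nonneg xy by simp
  show "\<psi> x < \<psi> y"
  proof (rule ccontr)
    assume "\<not> \<psi> x < \<psi> y"
    hence z: "b * (y - x) = 0" "(\<integral>s. ((1 - exp (- (y * s))) - (1 - exp (- (x * s)))) \<partial>\<nu>) = 0"
      using eq nn bn by linarith+
    from integral_nonneg_eq_0_iff_AE[OF int ae] z(2)
    have "AE s in \<nu>. (1 - exp (- (y * s))) - (1 - exp (- (x * s))) = 0" by simp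
    hence "AE s in \<nu>. s = 0" by eventually_elim (use xy in auto)
    from AE_nu_zero_imp_linear[OF this, of 1] psi_1 z(1) xy show False by simp
  qed
qed

lemma mono_psi: "mono_on {0..} \<psi>"
  by (rule strict_mono_on_imp_mono_on[OF strict_mono_psi])

lemma psi_pos: "x > 0 \<Longrightarrow> \<psi> x > 0"
  using strict_mono_onD[OF strict_mono_psi, of 0 x] psi_0 by simp

section \<open>Generating function of the subordinator step\<close>

abbreviation "step_law \<equiv> subordinator_step b \<nu>"

lemma pmf_step: "pmf step_law k = (if k = 0 then 0 else bernstein_coeff b \<nu> k)"
  by (rule pmf_subordinator_step[OF repr psi_0 psi_1])

lemma integrable_power_exp:
  "integrable \<nu> (\<lambda>s. s ^ Suc k * exp (- s))"
proof (rule integrable_nuI[where C = "fact (Suc k)"])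
  fix s :: real assume s: "s \<ge> 0"
  \<comment> \<open>One term of the exponential series. It is used with j = k + 1 for the constant
    bound, and with j = k after splitting off a factor s for the bound linear in s.\<close>
  have pw: "s ^ j \<le> fact j * exp s" for j
  proof -
    have "(\<Sum>i\<in>{j}. s ^ i /\<^sub>R fact i) \<le> exp s"
      unfolding exp_def by (rule sum_le_suminf) (use s summable_exp_generic[of s] in auto)
    thus ?thesis by (simp add: field_simps)
  qed
  have "s ^ Suc k * exp (- s) \<le> fact (Suc k) * exp s * exp (- s)"
    using pw[of "Suc k"] by (intro mult_right_mono) auto
  hence 1: "s ^ Suc k * exp (- s) \<le> fact (Suc k)"
    by (simp add: mult.assoc exp_minus_inverse del: fact_Suc power_Suc)
  have "s ^ k * exp (- s) \<le> fact k * exp s * exp (- s)"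
    using pw[of k] by (intro mult_right_mono) auto
  hence "s ^ k * exp (- s) \<le> fact k" by (simp add: mult.assoc exp_minus_inverse)
  also have "\<dots> \<le> fact (Suc k)" by (intro fact_mono) auto
  finally have 2: "s * (s ^ k * exp (- s)) \<le> s * fact (Suc k)" using s by (intro mult_left_mono) auto
  show "norm (s ^ Suc k * exp (- s)) \<le> fact (Suc k) * min 1 s"
    using 1 2 s by (auto simp: min_def mult_ac)
qed measurable

lemma coeff_pos:
  assumes nontriv: "\<not> (AE s in \<nu>. s = 0)"
  shows "pmf step_law (Suc k) > 0"
proof -
  have ae: "AE s in \<nu>. 0 \<le> s ^ Suc k * exp (- s)" by (rule AE_nu_I) simp
  have "(\<integral>s. s ^ Suc k * exp (- s) \<partial>\<nu>) \<noteq> 0"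
  proof
    assume "(\<integral>s. s ^ Suc k * exp (- s) \<partial>\<nu>) = 0"
    hence "AE s in \<nu>. s ^ Suc k * exp (- s) = 0"
      using integral_nonneg_eq_0_iff_AE[OF integrable_power_exp ae] by simp
    hence "AE s in \<nu>. s = 0" by eventually_elim auto
    thus False using nontriv by simp
  qed
  hence "(\<integral>s. s ^ Suc k * exp (- s) \<partial>\<nu>) > 0" using integral_nonneg_AE[OF ae] by linarith
  hence "bernstein_coeff b \<nu> (Suc k) > 0"
    unfolding bernstein_coeff_def using b_nonneg by (intro add_pos_nonneg mult_pos_pos) auto
  thus ?thesis by (simp add: pmf_step)
qed

text \<open>The weights come from the exponential series: summing exp(-s) (sz)^k / k! over k >= 1
  gives exp(-s(1-z)) - exp(-s), the difference of the integrands of \<open>Psi 1\<close> and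
  \<open>Psi (1 - z)\<close>; for the drift, bz = b - b(1-z). This identity expresses the law of the
  random time through \<psi>.\<close>

lemma expectation_power_step:
  fixes z :: complex
  assumes z: "norm z \<le> 1"
  shows "measure_pmf.expectation step_law (\<lambda>k. z ^ k) = 1 - Psi (1 - z)"
proof -
  define f where "f k s = complex_of_real (s ^ Suc k * exp (- s) / fact (Suc k)) * z ^ Suc k" for k s
  define C where "C k = (\<integral>s. s ^ Suc k * exp (- s) \<partial>\<nu>) / fact (Suc k)" for k
  have Re: "Re (1 - z) \<ge> 0" using complex_Re_le_cmod[of z] z by simp
  have norm1: "norm (z ^ k) \<le> 1" for k using z by (simp add: norm_power power_le_one)
  have coeff: "pmf step_law (Suc k) = C k + (if k = 0 then b else 0)" for k
    by (simp add: pmf_step bernstein_coeff_def C_def)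
  have C0: "C k \<ge> 0" for k
    unfolding C_def by (intro divide_nonneg_pos integral_nonneg_AE AE_nu_I) auto
  have sp: "summable (\<lambda>k. pmf step_law (Suc k))"
    using summable_Suc_iff[of "pmf step_law"] sums_integral_count_space_nat[OF integrable_pmf]
    by (auto simp: sums_iff)
  have intf: "integrable \<nu> (f k)" for k
    unfolding f_def by (intro integrable_mult_left integrable_of_real) (use integrable_power_exp[of k] in simp)
  have If: "(\<integral>s. f k s \<partial>\<nu>) = of_real (C k) * z ^ Suc k" for k
  proof -
    have "(\<integral>s. f k s \<partial>\<nu>) = (\<integral>s. complex_of_real (s ^ Suc k * exp (- s) / fact (Suc k)) \<partial>\<nu>) * z ^ Suc k"
      unfolding f_def by simp
    also have "(\<integral>s. complex_of_real (s ^ Suc k * exp (- s) / fact (Suc k)) \<partial>\<nu>) = of_real (C k)"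
      unfolding C_def by (subst integral_of_real) (use integrable_power_exp[of k] in auto)
    finally show ?thesis .
  qed
  have sums_f: "(\<lambda>k. f k s) sums (exp (- of_real s * (1 - z)) - exp (- of_real s))" for s
  proof -
    have "(\<lambda>k. (of_real s * z) ^ k /\<^sub>R fact k) sums exp (of_real s * z)" by (rule exp_converges)
    hence "(\<lambda>k. (of_real s * z) ^ Suc k /\<^sub>R fact (Suc k)) sums (exp (of_real s * z) - 1)"
      by (subst sums_Suc_iff) simp
    from sums_mult[OF this, of "exp (- of_real s)"]
    have "(\<lambda>k. exp (- of_real s) * ((of_real s * z) ^ Suc k /\<^sub>R fact (Suc k)))
      sums (exp (- of_real s) * (exp (of_real s * z) - 1))" .
    moreover have "exp (- of_real s) * ((of_real s * z) ^ Suc k /\<^sub>R fact (Suc k)) = f k s" for k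
      by (simp add: f_def power_mult_distrib scaleR_conv_of_real field_simps exp_of_real[symmetric] del: fact_Suc power_Suc)
    moreover have "exp (- of_real s) * (exp (of_real s * z) - 1) = exp (- of_real s * (1 - z)) - exp (- of_real s)"
      by (simp add: algebra_simps exp_add[symmetric])
    ultimately show ?thesis by simp
  qed
  have sumn: "summable (\<lambda>k. norm (f k s))" if "s \<ge> 0" for s
  proof (rule summable_comparison_test')
    show "summable (\<lambda>k. s ^ Suc k /\<^sub>R fact (Suc k))"
      using summable_exp_generic[of s] by (subst summable_Suc_iff)
    fix k show "norm (norm (f k s)) \<le> s ^ Suc k /\<^sub>R fact (Suc k)"
    proof -
      have "norm (f k s) = (s ^ Suc k / fact (Suc k)) * (exp (- s) * norm (z ^ Suc k))"
        using that by (simp add: f_def norm_mult norm_divide norm_power del: fact_Suc power_Suc)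
      also have "\<dots> \<le> (s ^ Suc k / fact (Suc k)) * (1 * 1)"
        by (intro mult_left_mono mult_mono norm1) (use that in auto)
      finally show ?thesis by (simp add: divide_inverse mult.commute)
    qed
  qed
  \<comment> \<open>Sum and integral are exchanged by absolute summability, since \<nu> need not be
    sigma-finite as Fubini would require. The norms integrate to at most the probabilities of the
    step law, which are summable.\<close>
  have sumI: "summable (\<lambda>k. (\<integral>s. norm (f k s) \<partial>\<nu>))"
  proof (rule summable_comparison_test'[OF sp])
    fix k
    have "(\<integral>s. norm (f k s) \<partial>\<nu>) \<le> (\<integral>s. s ^ Suc k * exp (- s) / fact (Suc k) \<partial>\<nu>)"
    proof (rule integral_mono_AE)
      show "integrable \<nu> (\<lambda>s. norm (f k s))" using intf by simp
      show "integrable \<nu> (\<lambda>s. s ^ Suc k * exp (- s) / fact (Suc k))"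
        using integrable_power_exp[of k] by simp
      show "AE s in \<nu>. norm (f k s) \<le> s ^ Suc k * exp (- s) / fact (Suc k)"
      proof (rule AE_nu_I)
        fix s :: real assume "s \<ge> 0"
        hence "norm (f k s) = (s ^ Suc k * exp (- s) / fact (Suc k)) * norm (z ^ Suc k)"
          by (simp add: f_def norm_mult norm_divide norm_power del: fact_Suc power_Suc)
        also have "\<dots> \<le> (s ^ Suc k * exp (- s) / fact (Suc k)) * 1"
          by (intro mult_left_mono norm1) (use \<open>s \<ge> 0\<close> in auto)
        finally show "norm (f k s) \<le> s ^ Suc k * exp (- s) / fact (Suc k)" by simp
      qed
    qed
    also have "\<dots> = C k" by (simp add: C_def)
    also have "\<dots> \<le> pmf step_law (Suc k)" using b_nonneg by (simp add: coeff)
    finally show "norm (\<integral>s. norm (f k s) \<partial>\<nu>) \<le> pmf step_law (Suc k)"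
      by (simp add: Bochner_Integration.integral_nonneg)
  qed
  have "(\<lambda>k. (\<integral>s. f k s \<partial>\<nu>)) sums (\<integral>s. (\<Sum>k. f k s) \<partial>\<nu>)"
    by (rule sums_integral[OF intf _ sumI]) (auto intro: AE_nu_I sumn)
  hence S1: "(\<lambda>k. of_real (C k) * z ^ Suc k) sums (\<integral>s. (exp (- of_real s * (1 - z)) - exp (- of_real s)) \<partial>\<nu>)"
    using sums_f by (simp add: If sums_iff del: power_Suc)
  have "(\<lambda>k. if k = 0 then of_real b * z else 0) sums (of_real b * z)"
    using sums_If_finite_set[of "{0::nat}" "\<lambda>_. of_real b * z"] by simp
  from sums_add[OF S1 this]
  have S2: "(\<lambda>k. of_real (pmf step_law (Suc k)) * z ^ Suc k) sums
     ((\<integral>s. (exp (- of_real s * (1 - z)) - exp (- of_real s)) \<partial>\<nu>) + of_real b * z)"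
    by (rule sums_cong[THEN iffD1, rotated]) (auto simp: coeff algebra_simps)
  have S3: "(\<lambda>k. of_real (pmf step_law k) * z ^ k) sums
     ((\<integral>s. (exp (- of_real s * (1 - z)) - exp (- of_real s)) \<partial>\<nu>) + of_real b * z)"
    by (rule sums_Suc_imp[OF _ S2]) (simp add: pmf_step)
  have int: "integrable (measure_pmf step_law) (\<lambda>k. z ^ k)"
    by (rule measure_pmf.integrable_const_bound[where B = 1]) (auto simp: norm1)
  hence int': "integrable (count_space UNIV) (\<lambda>k. of_real (pmf step_law k) * z ^ k)"
    by (simp add: measure_pmf_eq_density integrable_density scaleR_conv_of_real)
  have "measure_pmf.expectation step_law (\<lambda>k. z ^ k) = (\<integral>k. of_real (pmf step_law k) * z ^ k \<partial>count_space UNIV)"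
    by (simp add: measure_pmf_eq_density integral_density scaleR_conv_of_real)
  also have "\<dots> = (\<integral>s. (exp (- of_real s * (1 - z)) - exp (- of_real s)) \<partial>\<nu>) + of_real b * z"
    using sums_unique2[OF sums_integral_count_space_nat[OF int'] S3] .
  also have "(\<integral>s. (exp (- of_real s * (1 - z)) - exp (- of_real s)) \<partial>\<nu>) =
     (\<integral>s. ((1 - exp (- (of_real s * 1))) - (1 - exp (- (of_real s * (1 - z))))) \<partial>\<nu>)"
    by simp
  also have "\<dots> = (\<integral>s. (1 - exp (- (of_real s * 1))) \<partial>\<nu>) - (\<integral>s. (1 - exp (- (of_real s * (1 - z)))) \<partial>\<nu>)"
    by (intro Bochner_Integration.integral_diff integrable_one_minus_exp_complex) (use Re in auto)
  also have "\<dots> + of_real b * z = Psi 1 - Psi (1 - z)" by (simp add: Psi_def algebra_simps)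
  also have "Psi 1 = 1" using Psi_of_real[of 1] psi_1 by simp
  finally show ?thesis .
qed

text \<open>The random time has positive mass at both 1 and 2, so the subordinate walk is aperiodic even if
  \<open>S\<close> is periodic.\<close>

lemma norm_expectation_power_step_less:
  fixes z :: complex
  assumes nontriv: "\<not> (AE s in \<nu>. s = 0)" and z: "norm z \<le> 1" "z \<noteq> 1"
  shows "norm (measure_pmf.expectation step_law (\<lambda>k. z ^ k)) < 1"
proof -
  define c where "c k = pmf step_law k" for k
  have c: "c 1 > 0" "c 2 > 0" using coeff_pos[OF nontriv, of 0] coeff_pos[OF nontriv, of 1]
    by (auto simp: c_def numeral_2_eq_2)
  have norm1: "norm (z ^ k) \<le> 1" for k using z by (simp add: norm_power power_le_one)
  have int: "integrable (measure_pmf step_law) f" if "\<And>k. norm (f k) \<le> 1" for f :: "nat \<Rightarrow> complex"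
    by (rule measure_pmf.integrable_const_bound[where B = 1]) (auto simp: that)
  \<comment> \<open>The contribution of all jump sizes other than 1 and 2; it is estimated trivially
    by their total mass, so the strict gain has to come from the two terms left out.\<close>
  define g where "g k = (if k \<in> {1, 2} then 0 else z ^ k)" for k
  have gn: "norm (g k) \<le> 1 - indicat_real {1,2} k" for k using norm1[of k] by (auto simp: g_def)
  have gi: "integrable (measure_pmf step_law) g" by (rule int) (auto simp: g_def norm1)
  have "measure_pmf.expectation step_law (\<lambda>k. z ^ k - g k) = (\<Sum>k\<in>{1,2}. c k *\<^sub>R (z ^ k - g k))"
    unfolding c_def by (rule integral_measure_pmf) (auto simp: g_def split: if_splits)
  also have "\<dots> = of_real (c 1) * z + of_real (c 2) * z\<^sup>2"
    by (simp add: g_def scaleR_conv_of_real)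
  finally have 1: "measure_pmf.expectation step_law (\<lambda>k. z ^ k) =
      of_real (c 1) * z + of_real (c 2) * z\<^sup>2 + measure_pmf.expectation step_law g"
    by (subst (asm) Bochner_Integration.integral_diff) (auto intro!: int gi norm1 simp: algebra_simps)
  have "norm (measure_pmf.expectation step_law g) \<le> measure_pmf.expectation step_law (\<lambda>k. 1 - indicat_real {1,2} k)"
  proof (rule order_trans[OF integral_norm_bound], rule integral_mono)
    show "integrable (measure_pmf step_law) (\<lambda>k. norm (g k))" using gi by simp
    show "integrable (measure_pmf step_law) (\<lambda>k. 1 - indicat_real {1,2} k)"
      by (rule measure_pmf.integrable_const_bound[where B = 1]) (auto simp: indicator_def)
  qed (rule gn)
  also have "\<dots> = 1 - measure_pmf.prob step_law {1,2}"
  proof -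
    have "integrable (measure_pmf step_law) (indicat_real {1,2})"
      by (rule measure_pmf.integrable_const_bound[where B = 1]) (auto simp: indicator_def)
    thus ?thesis by (subst Bochner_Integration.integral_diff) auto
  qed
  also have "measure_pmf.prob step_law {1,2} = c 1 + c 2"
    by (subst measure_measure_pmf_finite) (auto simp: c_def)
  finally have 2: "norm (measure_pmf.expectation step_law g) \<le> 1 - (c 1 + c 2)" .
  \<comment> \<open>After a factor z is removed, two nonnegative multiples of 1 and z are added. In
    the squared norm the cross term 2 c1 c2 Re z is strictly below 2 c1 c2, as z = 1 is the only
    point of the closed disc with real part 1.\<close>
  have "norm (of_real (c 1) * z + of_real (c 2) * z\<^sup>2) < c 1 + c 2"
  proof -
    have "of_real (c 1) * z + of_real (c 2) * z\<^sup>2 = z * (of_real (c 1) + of_real (c 2) * z)"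
      by (simp add: power2_eq_square algebra_simps)
    hence "norm (of_real (c 1) * z + of_real (c 2) * z\<^sup>2) \<le> 1 * norm (of_real (c 1) + of_real (c 2) * z)"
      using z by (simp add: norm_mult mult_left_le_one_le)
    also have "\<dots> < c 1 + c 2"
    proof -
      have n1: "(norm z)\<^sup>2 \<le> 1" using z by (simp add: power_le_one)
      hence zz: "(Re z)\<^sup>2 + (Im z)\<^sup>2 \<le> 1" by (simp add: cmod_power2)
      have "Re z < 1"
      proof (rule ccontr)
        assume "\<not> Re z < 1"
        hence "Re z = 1" using complex_Re_le_cmod[of z] z by linarith
        with zz have "Im z = 0" by simp
        with \<open>Re z = 1\<close> show False using z by (simp add: complex_eq_iff)
      qed
      have "(norm (of_real (c 1) + of_real (c 2) * z))\<^sup>2 = (c 1)\<^sup>2 + 2 * (c 1 * c 2) * Re z + (c 2)\<^sup>2 * ((Re z)\<^sup>2 + (Im z)\<^sup>2)"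
        unfolding cmod_power2 by (simp add: power2_eq_square algebra_simps)
      also have "\<dots> < (c 1)\<^sup>2 + 2 * (c 1 * c 2) * 1 + (c 2)\<^sup>2 * 1"
        using c zz \<open>Re z < 1\<close> by (intro add_less_le_mono add_strict_left_mono mult_left_mono mult_strict_left_mono) auto
      also have "\<dots> = (c 1 + c 2)\<^sup>2" by (simp add: power2_eq_square algebra_simps)
      finally show ?thesis using c by (simp add: power2_less_imp_less)
    qed
    finally show ?thesis .
  qed
  with 1 2 norm_triangle_ineq[of "of_real (c 1) * z + of_real (c 2) * z\<^sup>2" "measure_pmf.expectation step_law g"]
  show ?thesis by simp
qed

end

subsection \<open>Fourier inversion on the integer lattice\<close>

lemma expectation_bind_pmf_complex:
  fixes f :: "'b \<Rightarrow> complex"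
  assumes "\<And>x. norm (f x) \<le> B"
  shows "measure_pmf.expectation (bind_pmf p q) f =
           measure_pmf.expectation p (\<lambda>x. measure_pmf.expectation (q x) f)"
proof -
  have real: "measure_pmf.expectation (bind_pmf p q) g =
           measure_pmf.expectation p (\<lambda>x. measure_pmf.expectation (q x) g)"
    if "\<And>x. \<bar>g x\<bar> \<le> B" for g :: "'b \<Rightarrow> real"
    unfolding measure_pmf_bind
    by (rule integral_bind[where K = "count_space UNIV" and B = B and B' = 1])
       (auto simp: that measure_pmf.emeasure_le_1 measure_pmf.finite_measure_axioms measure_pmf_in_subprob_algebra)
  have int: "integrable (measure_pmf r) f" for r
    by (rule measure_pmf.integrable_const_bound[where B = B]) (auto simp: assms)
  have bd: "norm (measure_pmf.expectation (q x) f) \<le> B" for x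
  proof (rule order_trans[OF integral_norm_bound])
    have "measure_pmf.expectation (q x) (\<lambda>y. norm (f y)) \<le> measure_pmf.expectation (q x) (\<lambda>y. B)"
      by (rule integral_mono) (use int assms in auto)
    thus "measure_pmf.expectation (q x) (\<lambda>y. norm (f y)) \<le> B" by simp
  qed
  have int2: "integrable (measure_pmf p) (\<lambda>x. measure_pmf.expectation (q x) f)"
    by (rule measure_pmf.integrable_const_bound[where B = B]) (auto simp: bd)
  show ?thesis
  proof (rule complex_eqI)
    have "\<bar>Re (f x)\<bar> \<le> B" for x using assms[of x] abs_Re_le_cmod order_trans by blast
    thus "Re (measure_pmf.expectation (bind_pmf p q) f) =
      Re (measure_pmf.expectation p (\<lambda>x. measure_pmf.expectation (q x) f))"
      using real[of "\<lambda>x. Re (f x)"] by (simp add: int int2)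
    have "\<bar>Im (f x)\<bar> \<le> B" for x using assms[of x] abs_Im_le_cmod order_trans by blast
    thus "Im (measure_pmf.expectation (bind_pmf p q) f) =
      Im (measure_pmf.expectation p (\<lambda>x. measure_pmf.expectation (q x) f))"
      using real[of "\<lambda>x. Im (f x)"] by (simp add: int int2)
  qed
qed

text \<open>Independence turns a multiplicative function of the sum into a product. The generality
  of a monoid serves two uses: characters on the lattice, and \<open>k \<mapsto> z ^ k\<close> on
  the random times.\<close>

lemma expectation_conv_pow:
  fixes f :: "'a::monoid_add \<Rightarrow> complex"
  assumes zero: "f 0 = 1" and add: "\<And>x y. f (x + y) = f x * f y" and le: "\<And>x. norm (f x) \<le> 1"
  shows "measure_pmf.expectation (conv_pow n q) f = measure_pmf.expectation q f ^ n"
proof (induction n)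
  case 0
  then show ?case by (simp add: zero)
next
  case (Suc n)
  have "measure_pmf.expectation (conv_pow (Suc n) q) f =
      measure_pmf.expectation (conv_pow n q) (\<lambda>x. measure_pmf.expectation q (\<lambda>y. f x * f y))"
    by (simp add: expectation_bind_pmf_complex[where B = 1, OF le] add)
  also have "\<dots> = measure_pmf.expectation (conv_pow n q) f * measure_pmf.expectation q f"
    by simp
  finally show ?case by (simp add: Suc.IH)
qed

definition fourier_char :: "real ^ 'd::finite \<Rightarrow> int ^ 'd \<Rightarrow> complex" where
  "fourier_char \<xi> x = cis (\<xi> \<bullet> real_vec x)"

lemma real_vec_simps [simp]:
  "real_vec 0 = 0" "real_vec (x + y) = real_vec x + real_vec y"
  by (simp_all add: real_vec_def vec_eq_iff)

lemma fourier_char_simps [simp]: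
  "fourier_char \<xi> 0 = 1" "fourier_char \<xi> (x + y) = fourier_char \<xi> x * fourier_char \<xi> y"
  "norm (fourier_char \<xi> x) = 1"
  by (simp_all add: fourier_char_def inner_add_right cis_mult)

text \<open>Conditioning on the random time replaces the character by a power of the characteristic
  function of p, so the generating function of the time is evaluated there.\<close>

lemma expectation_subordinate_walk:
  "measure_pmf.expectation (subordinate_walk p b \<nu> n) (fourier_char \<xi>) =
     measure_pmf.expectation (subordinator_step b \<nu>)
       (\<lambda>k. measure_pmf.expectation p (fourier_char \<xi>) ^ k) ^ n"
proof -
  let ?z = "measure_pmf.expectation p (fourier_char \<xi>)"
  have "norm ?z \<le> measure_pmf.expectation p (\<lambda>x. norm (fourier_char \<xi> x))" by (rule integral_norm_bound)
  hence z: "norm ?z \<le> 1" by simp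
  have "measure_pmf.expectation (subordinate_walk p b \<nu> n) (fourier_char \<xi>) =
      measure_pmf.expectation (conv_pow n (subordinator_step b \<nu>))
        (\<lambda>k. measure_pmf.expectation (conv_pow k p) (fourier_char \<xi>))"
    unfolding subordinate_walk_def by (rule expectation_bind_pmf_complex[where B = 1]) simp
  also have "\<dots> = measure_pmf.expectation (conv_pow n (subordinator_step b \<nu>)) (\<lambda>k. ?z ^ k)"
    by (simp add: expectation_conv_pow)
  also have "\<dots> = measure_pmf.expectation (subordinator_step b \<nu>) (\<lambda>k. ?z ^ k) ^ n"
    by (rule expectation_conv_pow) (use z in \<open>simp_all add: power_add norm_power power_le_one\<close>)
  finally show ?thesis .
qed

text \<open>A closed fundamental domain of the dual torus. Opposite faces coincide modulo 2 pi but
  are null sets, and closedness supplies the compactness used away from 0.\<close>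

definition fourier_cube :: "(real ^ 'd::finite) set" where
  "fourier_cube = cbox (\<chi> i. - pi) (\<chi> i. pi)"

lemma integral_cis_int:
  "(\<integral>t. indicat_real {-pi..pi} t *\<^sub>R cis (t * real_of_int k) \<partial>lborel) = (if k = 0 then 2 * pi else 0)"
proof (cases "k = 0")
  case True
  have "(\<integral>t. indicat_real {-pi..pi} t *\<^sub>R cis (t * real_of_int k) \<partial>lborel)
     = (\<integral>t. indicat_real {-pi..pi} t *\<^sub>R (1::complex) \<partial>lborel)" using True by simp
  also have "\<dots> = of_real (2 * pi)" by (subst integral_scaleR_left) (auto simp: scaleR_conv_of_real)
  finally show ?thesis using True by simp
next
  case False
  let ?F = "\<lambda>t. cis (t * real_of_int k) / (\<i> * of_int k)"
  have "(\<integral>t. indicat_real {-pi..pi} t *\<^sub>R cis (t * real_of_int k) \<partial>lborel) = ?F pi - ?F (- pi)"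
  proof (rule integral_FTC_atLeastAtMost)
    fix t :: real
    have "((\<lambda>t. cis (t * real_of_int k)) has_vector_derivative (real_of_int k *\<^sub>R (\<i> * cis (t * real_of_int k)))) (at t within {-pi..pi})"
    proof -
      have "((\<lambda>z. exp (z * (\<i> * of_int k))) has_field_derivative (of_int k * (\<i> * cis (t * real_of_int k)))) (at (complex_of_real t))"
        unfolding cis_conv_exp by (auto intro!: derivative_eq_intros simp: mult_ac)
      from has_vector_derivative_real_field[OF this, of "{-pi..pi}"] show ?thesis
        by (simp add: cis_conv_exp scaleR_conv_of_real mult_ac)
    qed
    from has_vector_derivative_divide[OF this, of "\<i> * of_int k"]
    show "(?F has_vector_derivative cis (t * real_of_int k)) (at t within {-pi..pi})"
      using False by (simp add: scaleR_conv_of_real)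
    show "continuous_on {- pi..pi} (\<lambda>t. cis (t * real_of_int k))" by (intro continuous_intros)
  qed simp
  also have "cis (pi * real_of_int k) = cis (- pi * real_of_int k)"
    by (simp add: complex_eq_iff)
  finally show ?thesis using False by simp
qed

text \<open>Orthogonality of characters. Lebesgue measure is the image of a product over the
  coordinate basis, and both the cube and the character factor, so the one-dimensional case
  suffices.\<close>

lemma integral_fourier_char:
  fixes x :: "int ^ 'd::finite"
  shows "(\<integral>\<xi>. indicat_real fourier_cube \<xi> *\<^sub>R fourier_char \<xi> x \<partial>lborel) = (if x = 0 then (2 * pi) ^ CARD('d) else 0)"
proof -
  interpret P: product_sigma_finite "\<lambda>_ :: real ^ 'd. lborel :: real measure"
    by standard
  define h where "h b t = indicat_real {-pi..pi} t *\<^sub>R cis (t * (real_vec x \<bullet> b))" for b :: "real ^ 'd" and t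
  have hint: "integrable lborel (h b)" for b
    unfolding h_def by (rule borel_integrable_compact[of "{-pi..pi}", unfolded indicator_scaleR_eq_if[symmetric]])
       (auto intro!: continuous_intros)
  have meas [measurable]: "(\<lambda>\<xi>. fourier_char \<xi> x) \<in> borel_measurable borel"
    unfolding fourier_char_def by (intro borel_measurable_continuous_onI continuous_intros)
  have cube: "fourier_cube \<in> sets (borel :: (real ^ 'd) measure)" by (simp add: fourier_cube_def)
  have inner: "(\<Sum>b\<in>Basis. f b *\<^sub>R b) \<bullet> c = f c" if "c \<in> Basis" for f and c :: "real ^ 'd"
    using that by (simp add: inner_sum_left inner_Basis if_distrib[of "\<lambda>t. _ * t"] sum.delta cong: if_cong)
  have "(\<integral>\<xi>. indicat_real fourier_cube \<xi> *\<^sub>R fourier_char \<xi> x \<partial>lborel) =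
     (\<integral>f. indicat_real fourier_cube (\<Sum>b\<in>Basis. f b *\<^sub>R b) *\<^sub>R fourier_char (\<Sum>b\<in>Basis. f b *\<^sub>R b) x \<partial>(\<Pi>\<^sub>M b\<in>(Basis :: (real ^ 'd) set). lborel))"
    by (subst lborel_eq, subst integral_distr) (use cube in auto)
  also have "\<dots> = (\<integral>f. (\<Prod>b\<in>Basis. h b (f b)) \<partial>(\<Pi>\<^sub>M b\<in>(Basis :: (real ^ 'd) set). lborel))"
  proof (rule Bochner_Integration.integral_cong[OF refl])
    fix f :: "real ^ 'd \<Rightarrow> real"
    let ?v = "\<Sum>b\<in>Basis. f b *\<^sub>R b"
    have "fourier_char ?v x = cis (\<Sum>b\<in>Basis. f b * (real_vec x \<bullet> b))"
      by (simp add: fourier_char_def inner_commute[of _ "real_vec x"] inner_sum_right)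
    also have "\<dots> = (\<Prod>b\<in>Basis. cis (f b * (real_vec x \<bullet> b)))"
      by (simp add: cis_conv_exp exp_sum[symmetric] sum_distrib_left)
    finally have 1: "fourier_char ?v x = (\<Prod>b\<in>Basis. cis (f b * (real_vec x \<bullet> b)))" .
    have "?v \<in> fourier_cube \<longleftrightarrow> (\<forall>b\<in>Basis. f b \<in> {-pi..pi})"
      unfolding fourier_cube_def mem_box
      by (intro ball_cong refl) (simp add: inner, auto simp: Basis_vec_def inner_axis)
    hence 2: "indicat_real fourier_cube ?v = (\<Prod>b\<in>Basis. indicat_real {-pi..pi} (f b))"
      by (auto simp: indicator_def prod_zero_iff)
    show "indicat_real fourier_cube ?v *\<^sub>R fourier_char ?v x = (\<Prod>b\<in>Basis. h b (f b))"
      unfolding 1 2 h_def by (simp add: scaleR_conv_of_real prod.distrib)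
  qed
  also have "\<dots> = (\<Prod>b\<in>(Basis :: (real ^ 'd) set). integral\<^sup>L lborel (h b))"
    by (rule P.product_integral_prod) (auto simp: hint)
  also have "\<dots> = (\<Prod>i\<in>(UNIV :: 'd set). integral\<^sup>L lborel (h (axis i 1)))"
    by (simp add: Basis_vec_def UNION_singleton_eq_range, subst prod.reindex)
       (auto simp: inj_on_def axis_eq_axis)
  also have "\<dots> = (\<Prod>i\<in>(UNIV :: 'd set). complex_of_real (if x $ i = 0 then 2 * pi else 0))"
  proof (rule prod.cong[OF refl])
    fix i :: 'd
    have "h (axis i 1) = (\<lambda>t. indicat_real {-pi..pi} t *\<^sub>R cis (t * real_of_int (x $ i)))"
      by (simp add: h_def fun_eq_iff inner_axis real_vec_def)
    thus "integral\<^sup>L lborel (h (axis i 1)) = complex_of_real (if x $ i = 0 then 2 * pi else 0)"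
      using integral_cis_int[of "x $ i"] by simp
  qed
  also have "\<dots> = (if x = 0 then (2 * pi) ^ CARD('d) else 0)"
  proof (cases "x = 0")
    case False
    then obtain i where "x $ i \<noteq> 0" by (auto simp: vec_eq_iff)
    thus ?thesis using False by (intro trans[OF prod_zero]) auto
  qed simp
  finally show ?thesis .
qed

text \<open>The law \<open>q\<close> will be that of the subordinate walk, whose support is in
  general infinite. Fubini applies because the modulus of the integrand is the indicator of a
  bounded cube, and orthogonality leaves only the point 0.\<close>

lemma fourier_inversion_zero:
  fixes q :: "(int ^ 'd::finite) pmf"
  shows "(\<integral>\<xi>. indicat_real fourier_cube \<xi> *\<^sub>R measure_pmf.expectation q (fourier_char \<xi>) \<partial>lborel)
     = of_real ((2 * pi) ^ CARD('d) * pmf q 0)"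
proof -
  interpret pair_sigma_finite "measure_pmf q" "lborel :: (real ^ 'd) measure" ..
  define F where "F x \<xi> = indicat_real fourier_cube \<xi> *\<^sub>R fourier_char \<xi> x" for x and \<xi> :: "real ^ 'd"
  have meas1: "F x \<in> borel_measurable borel" for x
  proof -
    have "(\<lambda>\<xi>. fourier_char \<xi> x) \<in> borel_measurable borel"
      unfolding fourier_char_def by (intro borel_measurable_continuous_onI continuous_intros)
    moreover have "fourier_cube \<in> sets (borel :: (real ^ 'd) measure)" by (simp add: fourier_cube_def)
    ultimately show ?thesis unfolding F_def by measurable
  qed
  have "(\<lambda>(x, \<xi>). F x \<xi>) \<in> borel_measurable (count_space UNIV \<Otimes>\<^sub>M (lborel :: (real ^ 'd) measure))"
    by (rule measurable_pair_measure_countable1[OF countableI_type]) (use meas1 in simp)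
  hence meas: "(\<lambda>(x, \<xi>). F x \<xi>) \<in> borel_measurable (measure_pmf q \<Otimes>\<^sub>M (lborel :: (real ^ 'd) measure))"
    by (subst measurable_cong_sets[OF sets_pair_measure_cong[OF sets_measure_pmf_count_space refl] refl])
  have normF: "norm (F x \<xi>) = indicat_real fourier_cube \<xi>" for x \<xi> by (simp add: F_def)
  have cubefin: "emeasure lborel (fourier_cube :: (real ^ 'd) set) < \<infinity>"
    unfolding fourier_cube_def by (rule emeasure_lborel_cbox_finite)
  have int: "integrable lborel (indicat_real (fourier_cube :: (real ^ 'd) set))"
    using cubefin by (auto simp: fourier_cube_def)
  have "integrable (measure_pmf q \<Otimes>\<^sub>M (lborel :: (real ^ 'd) measure)) (\<lambda>(x, \<xi>). F x \<xi>)"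
  proof (rule Fubini_integrable[OF meas])
    show "integrable (measure_pmf q) (\<lambda>x. \<integral>\<xi>. norm (case (x, \<xi>) of (x, \<xi>) \<Rightarrow> F x \<xi>) \<partial>lborel)"
      by (simp add: normF)
    show "AE x in measure_pmf q. integrable lborel (\<lambda>\<xi>. case (x, \<xi>) of (x, \<xi>) \<Rightarrow> F x \<xi>)"
    proof (intro AE_I2)
      fix x
      show "integrable lborel (\<lambda>\<xi>. case (x, \<xi>) of (x, \<xi>) \<Rightarrow> F x \<xi>)"
        by (rule Bochner_Integration.integrable_bound[OF int]) (use meas1 normF in auto)
    qed
  qed
  from Fubini_integral[OF this]
  have "(\<integral>\<xi>. \<integral>x. F x \<xi> \<partial>measure_pmf q \<partial>lborel) = (\<integral>x. \<integral>\<xi>. F x \<xi> \<partial>lborel \<partial>measure_pmf q)" .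
  also have "\<dots> = (\<integral>x. complex_of_real ((2 * pi) ^ CARD('d) * indicat_real {0} x) \<partial>measure_pmf q)"
    by (intro Bochner_Integration.integral_cong) (auto simp: F_def integral_fourier_char)
  also have "\<dots> = of_real ((2 * pi) ^ CARD('d) * measure_pmf.expectation q (indicat_real {0}))"
    by (subst integral_complex_of_real) simp
  also have "measure_pmf.expectation q (indicat_real {0}) = pmf q 0"
    by (simp add: pmf.rep_eq)
  finally show ?thesis by (simp add: F_def)
qed

subsection \<open>The characteristic function of a walk in the class S\<close>

lemma expectation_fourier_char:
  assumes "finite (set_pmf p)"
  shows "measure_pmf.expectation p (fourier_char \<xi>) = (\<Sum>v\<in>set_pmf p. of_real (pmf p v) * cis (\<xi> \<bullet> real_vec v))"
  by (subst integral_measure_pmf[OF assms]) (auto simp: fourier_char_def scaleR_conv_of_real)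

lemma norm_expectation_fourier_char_le: "norm (measure_pmf.expectation p (fourier_char \<xi>)) \<le> 1"
  using integral_norm_bound[of "measure_pmf p" "fourier_char \<xi>"] by simp

lemma continuous_on_expectation_fourier_char:
  assumes "finite (set_pmf p)"
  shows "continuous_on A (\<lambda>\<xi>. measure_pmf.expectation p (fourier_char \<xi>))"
  unfolding expectation_fourier_char[OF assms] by (intro continuous_intros)

lemma conv_pow_closed:
  assumes "v \<in> set_pmf (conv_pow n p)" "P 0" "\<And>x y. P x \<Longrightarrow> y \<in> set_pmf p \<Longrightarrow> P (x + y)"
  shows "P v"
  using assms(1) by (induction n arbitrary: v) (auto intro: assms(2,3))

text \<open>Reachability of every lattice point, recast as an induction principle: what holds at 0
  and persists under steps of p holds on the whole lattice.\<close>

lemma class_S_induct: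
  assumes "class_S p" "P 0" "\<And>x y. P x \<Longrightarrow> y \<in> set_pmf p \<Longrightarrow> P (x + y)"
  shows "P v"
proof -
  obtain n where "pmf (conv_pow n p) v > 0" using assms(1) unfolding class_S_def by blast
  thus ?thesis using conv_pow_closed[of v n p P] assms(2,3) by (auto simp: set_pmf_iff)
qed

lemma real_vec_axis: "real_vec (axis i 1) = axis i 1"
  by (simp add: real_vec_def axis_def vec_eq_iff)

text \<open>A direction of zero variance is orthogonal to every step, hence by induction to every
  lattice point, in particular to the unit vectors.\<close>

lemma cov_matrix_pos_def:
  fixes p :: "(int ^ 'd::finite) pmf"
  assumes p: "class_S p" and u: "u \<noteq> 0"
  shows "(cov_matrix p *v u) \<bullet> u > 0"
proof (rule ccontr)
  have fin: "finite (set_pmf p)" using p by (simp add: class_S_def)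
  assume "\<not> ?thesis"
  hence "(\<Sum>v\<in>set_pmf p. pmf p v * (real_vec v \<bullet> u)\<^sup>2) \<le> 0" by (simp add: cov_matrix_quadratic_form)
  moreover have "(\<Sum>v\<in>set_pmf p. pmf p v * (real_vec v \<bullet> u)\<^sup>2) \<ge> 0" by (intro sum_nonneg) auto
  ultimately have "(\<Sum>v\<in>set_pmf p. pmf p v * (real_vec v \<bullet> u)\<^sup>2) = 0" by linarith
  hence orth: "\<forall>v\<in>set_pmf p. real_vec v \<bullet> u = 0"
    using fin by (subst (asm) sum_nonneg_eq_0_iff) (auto simp: set_pmf_iff)
  have "real_vec v \<bullet> u = 0" for v
    by (rule class_S_induct[OF p, of "\<lambda>v. real_vec v \<bullet> u = 0"]) (use orth in \<open>auto simp: inner_add_left\<close>)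
  hence "real_vec (axis i 1) \<bullet> u = 0" for i .
  hence "u $ i = 0" for i by (simp add: real_vec_axis inner_axis')
  hence "u = 0" by (simp add: vec_eq_iff)
  with u show False by simp
qed

lemma cov_matrix_lower_bound:
  fixes p :: "(int ^ 'd::finite) pmf"
  assumes p: "class_S p"
  obtains m where "m > 0" "\<And>u. (cov_matrix p *v u) \<bullet> u \<ge> m * (norm u)\<^sup>2"
proof -
  have cont: "continuous_on (sphere 0 1) (\<lambda>u. (cov_matrix p *v u) \<bullet> u)"
    by (intro continuous_intros linear_continuous_on) (simp add: matrix_vector_mul_bounded_linear)
  have ne: "sphere 0 1 \<noteq> ({} :: (real ^ 'd) set)" by simp
  obtain w where w: "w \<in> sphere 0 1"
    "\<And>u. u \<in> sphere 0 1 \<Longrightarrow> (cov_matrix p *v w) \<bullet> w \<le> (cov_matrix p *v u) \<bullet> u"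
    using continuous_attains_inf[OF compact_sphere ne cont] by blast
  show ?thesis
  proof (rule that)
    show "(cov_matrix p *v w) \<bullet> w > 0" using w(1) by (intro cov_matrix_pos_def[OF p]) auto
    fix u :: "real ^ 'd"
    show "(cov_matrix p *v w) \<bullet> w * (norm u)\<^sup>2 \<le> (cov_matrix p *v u) \<bullet> u"
    proof (cases "u = 0")
      case False
      let ?u = "(1 / norm u) *\<^sub>R u"
      have "(cov_matrix p *v w) \<bullet> w \<le> (cov_matrix p *v ?u) \<bullet> ?u" by (rule w(2)) (use False in simp)
      also have "\<dots> = (cov_matrix p *v u) \<bullet> u / (norm u)\<^sup>2"
        by (simp add: matrix_vector_mult_scaleR power2_eq_square)
      finally show ?thesis using False by (simp add: field_simps)
    qed simp
  qed
qed

text \<open>An average of unit complex numbers equals 1 only if each of them does, so the character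
  is trivial on all steps and then on the lattice. The value 1, not modulus 1, is the right
  hypothesis: for a periodic walk the modulus can be 1 elsewhere in the cube.\<close>

lemma expectation_fourier_char_eq_1:
  fixes p :: "(int ^ 'd::finite) pmf"
  assumes p: "class_S p" and \<xi>: "\<xi> \<in> fourier_cube" and eq: "measure_pmf.expectation p (fourier_char \<xi>) = 1"
  shows "\<xi> = 0"
proof -
  have fin: "finite (set_pmf p)" using p by (simp add: class_S_def)
  have "(\<Sum>v\<in>set_pmf p. pmf p v * (1 - cos (\<xi> \<bullet> real_vec v))) = 1 - Re (measure_pmf.expectation p (fourier_char \<xi>))"
    using fin sum_pmf_eq_1[OF fin order_refl]
    by (simp add: expectation_fourier_char right_diff_distrib sum_subtractf)
  hence "(\<Sum>v\<in>set_pmf p. pmf p v * (1 - cos (\<xi> \<bullet> real_vec v))) = 0" using eq by simp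
  hence "\<forall>v\<in>set_pmf p. cos (\<xi> \<bullet> real_vec v) = 1"
    using fin by (subst (asm) sum_nonneg_eq_0_iff) (auto simp: set_pmf_iff)
  hence cis1: "\<forall>v\<in>set_pmf p. fourier_char \<xi> v = 1"
  proof -
    have "sin t = 0" if "cos t = 1" for t :: real using that cos_one_sin_zero by blast
    thus ?thesis using \<open>\<forall>v\<in>set_pmf p. cos (\<xi> \<bullet> real_vec v) = 1\<close>
      by (simp add: fourier_char_def complex_eq_iff)
  qed
  have all: "fourier_char \<xi> v = 1" for v
    by (rule class_S_induct[OF p, of "\<lambda>v. fourier_char \<xi> v = 1"]) (use cis1 in auto)
  have "\<xi> $ i = 0" for i
  proof -
    have "cos (\<xi> $ i) = 1"
      using all[of "axis i 1"] by (simp add: fourier_char_def real_vec_axis inner_axis complex_eq_iff)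
    then obtain n :: int where n: "\<xi> $ i = of_int n * 2 * pi" by (auto simp: cos_one_2pi_int)
    have "\<bar>\<xi> $ i\<bar> \<le> pi" using \<xi> by (auto simp: fourier_cube_def mem_box_cart abs_le_iff minus_le_iff)
    hence "\<bar>of_int n :: real\<bar> * 2 \<le> 1" using n by (simp add: abs_mult)
    hence "n = 0" by linarith
    thus ?thesis using n by simp
  qed
  thus ?thesis by (simp add: vec_eq_iff)
qed

text \<open>Second-order Taylor expansion of each character: total mass 1 and zero mean remove the
  first two terms, and the third absolute moment of p controls the remainder.\<close>

lemma expectation_fourier_char_expansion:
  fixes p :: "(int ^ 'd::finite) pmf"
  assumes p: "class_S p"
  obtains K where "K > 0" "\<And>\<xi>. norm (1 - measure_pmf.expectation p (fourier_char \<xi>)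
       - of_real ((cov_matrix p *v \<xi>) \<bullet> \<xi> / 2)) \<le> K * norm \<xi> ^ 3"
proof -
  have fin: "finite (set_pmf p)" using p by (simp add: class_S_def)
  have mean: "(\<Sum>v\<in>set_pmf p. pmf p v *\<^sub>R real_vec v) = 0" using p by (simp add: class_S_def)
  define K where "K = (\<Sum>v\<in>set_pmf p. pmf p v * norm (real_vec v) ^ 3)"
  have K: "K \<ge> 0" unfolding K_def by (intro sum_nonneg) auto
  have "norm (1 - measure_pmf.expectation p (fourier_char \<xi>) - of_real ((cov_matrix p *v \<xi>) \<bullet> \<xi> / 2)) \<le> K * norm \<xi> ^ 3" for \<xi>
  proof -
    let ?t = "\<lambda>v. \<xi> \<bullet> real_vec v"
    have s1: "(\<Sum>v\<in>set_pmf p. complex_of_real (pmf p v)) = 1"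
      using sum_pmf_eq_1[OF fin order_refl] by (simp flip: of_real_sum)
    have "(\<Sum>v\<in>set_pmf p. pmf p v * ?t v) = \<xi> \<bullet> (\<Sum>v\<in>set_pmf p. pmf p v *\<^sub>R real_vec v)"
      by (simp add: inner_sum_right)
    hence r2: "(\<Sum>v\<in>set_pmf p. pmf p v * ?t v) = 0" unfolding mean by simp
    have s2: "(\<Sum>v\<in>set_pmf p. complex_of_real (pmf p v * ?t v)) = 0"
      using arg_cong[OF r2, of complex_of_real] by (simp only: of_real_sum of_real_0)
    have s3: "complex_of_real ((cov_matrix p *v \<xi>) \<bullet> \<xi>) = (\<Sum>v\<in>set_pmf p. of_real (pmf p v * (?t v)\<^sup>2))"
      unfolding cov_matrix_quadratic_form by (simp add: inner_commute[of \<xi>])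
    have "(\<Sum>v\<in>set_pmf p. of_real (pmf p v) * (cis (?t v) - (1 + \<i> * of_real (?t v) - of_real ((?t v)\<^sup>2) / 2)))
      = measure_pmf.expectation p (fourier_char \<xi>) - (\<Sum>v\<in>set_pmf p. complex_of_real (pmf p v))
        - \<i> * (\<Sum>v\<in>set_pmf p. complex_of_real (pmf p v * ?t v))
        + (\<Sum>v\<in>set_pmf p. of_real (pmf p v * (?t v)\<^sup>2)) / 2"
      unfolding expectation_fourier_char[OF fin]
      by (simp add: algebra_simps sum.distrib sum_subtractf sum_distrib_left sum_divide_distrib)
    also have "\<dots> = - (1 - measure_pmf.expectation p (fourier_char \<xi>) - of_real ((cov_matrix p *v \<xi>) \<bullet> \<xi> / 2))"
      by (simp only: s1 s2 of_real_divide s3) simp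
    finally have "norm (1 - measure_pmf.expectation p (fourier_char \<xi>) - of_real ((cov_matrix p *v \<xi>) \<bullet> \<xi> / 2))
      = norm (\<Sum>v\<in>set_pmf p. of_real (pmf p v) * (cis (?t v) - (1 + \<i> * of_real (?t v) - of_real ((?t v)\<^sup>2) / 2)))"
      by (simp only: norm_minus_cancel)
    also have "\<dots> \<le> (\<Sum>v\<in>set_pmf p. pmf p v * (norm (real_vec v) ^ 3 * norm \<xi> ^ 3))"
    proof (rule sum_norm_le)
      fix v
      have "norm (cis (?t v) - (1 + \<i> * of_real (?t v) - of_real ((?t v)\<^sup>2) / 2)) \<le> \<bar>?t v\<bar> ^ 3 / 6"
        using iexp_approx1[of "?t v" 2]
        by (simp add: cis_conv_exp numeral_2_eq_2 numeral_3_eq_3 power_mult_distrib algebra_simps)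
      also have "\<dots> \<le> \<bar>?t v\<bar> ^ 3" by simp
      also have "\<dots> \<le> (norm \<xi> * norm (real_vec v)) ^ 3"
        by (intro power_mono Cauchy_Schwarz_ineq2) auto
      also have "\<dots> = norm (real_vec v) ^ 3 * norm \<xi> ^ 3" by (simp only: power_mult_distrib mult.commute)
      finally show "norm (of_real (pmf p v) * (cis (?t v) - (1 + \<i> * of_real (?t v) - of_real ((?t v)\<^sup>2) / 2)))
        \<le> pmf p v * (norm (real_vec v) ^ 3 * norm \<xi> ^ 3)"
        by (simp add: norm_mult mult_left_mono)
    qed
    also have "\<dots> = K * norm \<xi> ^ 3" by (simp add: K_def sum_distrib_right mult.assoc)
    finally show ?thesis .
  qed
  \<comment> \<open>Passing to K + 1 makes the constant positive without discussing whether the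
    third moment vanishes.\<close>
  moreover have "K * norm \<xi> ^ 3 \<le> (K + 1) * norm \<xi> ^ 3" for \<xi> :: "real ^ 'd"
    by (intro mult_right_mono) auto
  ultimately have "norm (1 - measure_pmf.expectation p (fourier_char \<xi>) - of_real ((cov_matrix p *v \<xi>) \<bullet> \<xi> / 2))
      \<le> (K + 1) * norm \<xi> ^ 3" for \<xi>
    by (rule order_trans)
  thus ?thesis using K by (intro that[of "K + 1"]) simp_all
qed

text \<open>Near 0 the argument of \<open>Psi\<close> stays in a narrow cone about the positive
  axis, which limits the loss in \<open>norm_Psi_diff_le\<close> to a quarter of
  \<open>\<psi> x\<close>. A real part of at most 1 keeps \<open>1 - \<psi> x\<close>
  nonnegative.\<close>

lemma expectation_fourier_char_near_0:
  fixes p :: "(int ^ 'd::finite) pmf"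
  assumes p: "class_S p"
  obtains c \<delta> where "c > 0" "\<delta> > 0"
    "\<And>\<xi>. norm \<xi> \<le> \<delta> \<Longrightarrow> c * (norm \<xi>)\<^sup>2 \<le> 1 - Re (measure_pmf.expectation p (fourier_char \<xi>))"
    "\<And>\<xi>. norm \<xi> \<le> \<delta> \<Longrightarrow> 1 - Re (measure_pmf.expectation p (fourier_char \<xi>)) \<le> 1"
    "\<And>\<xi>. norm \<xi> \<le> \<delta> \<Longrightarrow> \<bar>Im (measure_pmf.expectation p (fourier_char \<xi>))\<bar>
        \<le> (1 - Re (measure_pmf.expectation p (fourier_char \<xi>))) / 4"
proof -
  let ?\<phi> = "\<lambda>\<xi>. measure_pmf.expectation p (fourier_char \<xi>)"
  have fin: "finite (set_pmf p)" using p by (simp add: class_S_def)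
  obtain m where m: "m > 0" "\<And>u. (cov_matrix p *v u) \<bullet> u \<ge> m * (norm u)\<^sup>2"
    using cov_matrix_lower_bound[OF p] by blast
  obtain K where K: "K > 0" "\<And>\<xi>. norm (1 - ?\<phi> \<xi> - of_real ((cov_matrix p *v \<xi>) \<bullet> \<xi> / 2)) \<le> K * norm \<xi> ^ 3"
    using expectation_fourier_char_expansion[OF p] by blast
  have "isCont ?\<phi> 0"
    using continuous_on_expectation_fourier_char[OF fin, of UNIV] by (simp add: continuous_on_eq_continuous_at)
  moreover have "?\<phi> 0 = 1"
  proof -
    have "fourier_char 0 = (\<lambda>_ :: int ^ 'd. 1)" by (simp add: fourier_char_def fun_eq_iff)
    thus ?thesis by simp
  qed
  ultimately obtain d where d: "d > 0" "\<And>\<xi>. norm \<xi> < d \<Longrightarrow> norm (?\<phi> \<xi> - 1) < 1"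
    unfolding continuous_at_eps_delta by (auto simp: dist_norm dest: spec[of _ 1])
  \<comment> \<open>The second entry makes the cubic error at most m/10 times the square of the
    norm. The real part then keeps m/2 - m/10 = 2m/5, four times the bound m/10 for the imaginary
    part; the first entry keeps the characteristic function within distance 1 of 1.\<close>
  define \<delta> where "\<delta> = min (d / 2) (m / (10 * K))"
  have key: "\<bar>1 - Re (?\<phi> \<xi>) - (cov_matrix p *v \<xi>) \<bullet> \<xi> / 2\<bar> \<le> m / 10 * (norm \<xi>)\<^sup>2" "\<bar>Im (?\<phi> \<xi>)\<bar> \<le> m / 10 * (norm \<xi>)\<^sup>2"
    if "norm \<xi> \<le> \<delta>" for \<xi>
  proof -
    have "K * norm \<xi> \<le> m / 10" using that K(1) by (simp add: \<delta>_def field_simps)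
    hence "K * norm \<xi> * (norm \<xi>)\<^sup>2 \<le> m / 10 * (norm \<xi>)\<^sup>2" by (intro mult_right_mono) auto
    hence le: "norm (1 - ?\<phi> \<xi> - of_real ((cov_matrix p *v \<xi>) \<bullet> \<xi> / 2)) \<le> m / 10 * (norm \<xi>)\<^sup>2"
      using K(2)[of \<xi>] by (simp add: power3_eq_cube power2_eq_square mult_ac)
    show "\<bar>1 - Re (?\<phi> \<xi>) - (cov_matrix p *v \<xi>) \<bullet> \<xi> / 2\<bar> \<le> m / 10 * (norm \<xi>)\<^sup>2"
      using order_trans[OF abs_Re_le_cmod le] by simp
    show "\<bar>Im (?\<phi> \<xi>)\<bar> \<le> m / 10 * (norm \<xi>)\<^sup>2"
      using order_trans[OF abs_Im_le_cmod le] by simp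
  qed
  have low: "2 * m / 5 * (norm \<xi>)\<^sup>2 \<le> 1 - Re (?\<phi> \<xi>)" if "norm \<xi> \<le> \<delta>" for \<xi>
  proof -
    have "m / 10 * (norm \<xi>)\<^sup>2 = m * (norm \<xi>)\<^sup>2 / 10" "2 * m / 5 * (norm \<xi>)\<^sup>2 = 2 * (m * (norm \<xi>)\<^sup>2) / 5"
      by simp_all
    with key(1)[OF that] m(2)[of \<xi>] show ?thesis by linarith
  qed
  show ?thesis
  proof (rule that)
    show "2 * m / 5 > 0" "\<delta> > 0" using m d K by (auto simp: \<delta>_def)
    fix \<xi> :: "real ^ 'd" assume \<xi>: "norm \<xi> \<le> \<delta>"
    show "2 * m / 5 * (norm \<xi>)\<^sup>2 \<le> 1 - Re (?\<phi> \<xi>)" by (rule low[OF \<xi>])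
    have "norm (?\<phi> \<xi> - 1) < 1" using \<xi> d by (intro d) (auto simp: \<delta>_def)
    thus "1 - Re (?\<phi> \<xi>) \<le> 1" using abs_Re_le_cmod[of "?\<phi> \<xi> - 1"] by simp
    show "\<bar>Im (?\<phi> \<xi>)\<bar> \<le> (1 - Re (?\<phi> \<xi>)) / 4" using key(2)[OF \<xi>] low[OF \<xi>] by simp
  qed
qed

text \<open>Complex version of the exponential limit: \<open>w n\<close> tends to 0, so n-th powers
  can be taken through the principal logarithm near 1.\<close>

lemma tendsto_one_minus_power_complex:
  fixes w :: "nat \<Rightarrow> complex"
  assumes lim: "(\<lambda>n. of_nat n * w n) \<longlonglongrightarrow> L"
  shows "(\<lambda>n. (1 - w n) ^ n) \<longlonglongrightarrow> exp (- L)"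
proof -
  have "(\<lambda>n. of_nat n * w n * (1 / of_nat n)) \<longlonglongrightarrow> L * 0"
    by (intro tendsto_mult lim lim_1_over_n)
  moreover have "\<forall>\<^sub>F n in sequentially. of_nat n * w n * (1 / of_nat n) = w n"
    by (rule eventually_mono[OF eventually_gt_at_top[of 0]]) simp
  ultimately have w0: "w \<longlonglongrightarrow> 0" by (simp add: Lim_transform_eventually)
  \<comment> \<open>The Caratheodory form of this derivative factors \<open>Ln (1 - w n)\<close>
    through \<open>w n\<close> even where \<open>w n\<close> is 0, so no quotient by
    \<open>w n\<close> appears.\<close>
  have "(Ln has_field_derivative 1) (at 1)"
    by (auto intro!: derivative_eq_intros)
  then obtain g where g: "\<And>z. Ln z - Ln 1 = g z * (z - 1)" "isCont g 1" "g 1 = 1"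
    unfolding CARAT_DERIV by blast
  have "(\<lambda>n. 1 - w n) \<longlonglongrightarrow> 1 - 0" by (intro tendsto_intros w0)
  hence w1: "(\<lambda>n. 1 - w n) \<longlonglongrightarrow> 1" by simp
  have "(\<lambda>n. g (1 - w n)) \<longlonglongrightarrow> 1" using isCont_tendsto_compose[OF g(2) w1] g(3) by simp
  hence "(\<lambda>n. - (g (1 - w n) * (of_nat n * w n))) \<longlonglongrightarrow> - (1 * L)"
    by (intro tendsto_intros lim)
  hence "(\<lambda>n. exp (- (g (1 - w n) * (of_nat n * w n)))) \<longlonglongrightarrow> exp (- L)"
    by (intro tendsto_exp) simp
  moreover have "\<forall>\<^sub>F n in sequentially. exp (- (g (1 - w n) * (of_nat n * w n))) = (1 - w n) ^ n"
  proof -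
    have "\<forall>\<^sub>F n in sequentially. 1 - w n \<noteq> 0" using w1 by (rule tendsto_imp_eventually_ne) simp
    thus ?thesis
    proof eventually_elim
      case (elim n)
      have "- (g (1 - w n) * (of_nat n * w n)) = of_nat n * Ln (1 - w n)"
        using g(1)[of "1 - w n"] by (simp add: algebra_simps)
      thus ?case using elim by (simp add: exp_of_nat_mult)
    qed
  qed
  ultimately show ?thesis by (rule Lim_transform_eventually)
qed

text \<open>Continuity is wanted up to the boundary circle, which the characteristic function of p
  does reach; the weights have total mass 1, so dominated convergence covers the closed
  disc.\<close>

lemma continuous_on_expectation_power:
  "continuous_on (cball 0 1) (\<lambda>z::complex. measure_pmf.expectation (r :: nat pmf) (\<lambda>k. z ^ k))"
proof (rule continuous_on_sequentiallyI)
  fix z :: "nat \<Rightarrow> complex" and z0 assume z: "\<forall>n. z n \<in> cball 0 1" "z0 \<in> cball 0 1" "z \<longlonglongrightarrow> z0"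
  show "(\<lambda>n. measure_pmf.expectation r (\<lambda>k. z n ^ k)) \<longlonglongrightarrow> measure_pmf.expectation r (\<lambda>k. z0 ^ k)"
  proof (rule integral_dominated_convergence[where w = "\<lambda>_. 1"])
    show "AE k in measure_pmf r. (\<lambda>n. z n ^ k) \<longlonglongrightarrow> z0 ^ k"
      by (intro AE_I2 tendsto_power z)
    show "AE k in measure_pmf r. norm (z n ^ k) \<le> 1" for n
      using z by (intro AE_I2) (auto simp: norm_power power_le_one)
  qed auto
qed

subsection \<open>Asymptotics of the return probability\<close>

lemma integral_lborel_scale:
  fixes F :: "'a::euclidean_space \<Rightarrow> complex"
  assumes F [measurable]: "F \<in> borel_measurable borel" and s: "s > 0"
  shows "(\<integral>\<xi>. F \<xi> \<partial>lborel) = of_real (s ^ DIM('a)) * (\<integral>u. F (s *\<^sub>R u) \<partial>lborel)"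
proof -
  have "(\<integral>\<xi>. F \<xi> \<partial>lborel) = (\<integral>\<xi>. F \<xi> \<partial>density (distr lborel borel (\<lambda>x. 0 + s *\<^sub>R x)) (\<lambda>_. \<bar>s\<bar> ^ DIM('a)))"
    by (subst lborel_affine[of s 0]) (use s in auto)
  also have "\<dots> = (\<integral>\<xi>. (s ^ DIM('a)) *\<^sub>R F \<xi> \<partial>distr lborel borel (\<lambda>x. 0 + s *\<^sub>R x))"
    using s by (subst integral_density) auto
  also have "\<dots> = (\<integral>u. (s ^ DIM('a)) *\<^sub>R F (s *\<^sub>R u) \<partial>lborel)"
    by (subst integral_distr) auto
  finally show ?thesis by (simp add: scaleR_conv_of_real)
qed

lemma integrable_exp_minus_norm_powr:
  assumes a: "a > 0" and g: "g > 0"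
  shows "integrable lborel (\<lambda>u::real ^ 'n::finite. exp (- ((a * (norm u)\<^sup>2) powr g)))"
proof (rule integrableI_nonneg)
  \<comment> \<open>The scalar 2a cancels the division by 2 in the Gaussian-type integral already
    computed.\<close>
  define Q :: "real ^ 'n ^ 'n" where "Q = mat (2 * a)"
  have Q: "(Q *v u) \<bullet> u = 2 * (a * (norm u)\<^sup>2)" for u
  proof -
    have "Q *v u = (2 * a) *\<^sub>R u"
      by (simp add: Q_def vec_eq_iff matrix_vector_mult_def mat_def if_distrib[of "\<lambda>x. x * _"] cong: if_cong)
    thus ?thesis by (simp add: power2_norm_eq_inner)
  qed
  have "transpose Q = Q" by (simp add: Q_def transpose_mat)
  moreover have "(Q *v u) \<bullet> u > 0" if "u \<noteq> 0" for u using a that by (simp add: Q)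
  ultimately have "(\<integral>\<^sup>+u. ennreal (exp (- (((Q *v u) \<bullet> u / 2) powr g))) \<partial>lborel) < \<infinity>"
    by (subst nn_integral_exp_quadratic_powr[OF _ _ g]) auto
  thus "(\<integral>\<^sup>+u. ennreal (exp (- ((a * (norm (u :: real ^ 'n))\<^sup>2) powr g))) \<partial>lborel) < \<infinity>"
    by (simp add: Q)
qed auto

section \<open>Characteristic function of one step of the subordinate walk\<close>

context bernstein_laplace
begin

text \<open>Defined as an expectation, which yields the modulus bound and continuity directly;
  \<open>walk_char_eq\<close> supplies the form in terms of \<open>Psi\<close> used for the
  asymptotics.\<close>

definition walk_char :: "(int ^ 'd::finite) pmf \<Rightarrow> real ^ 'd \<Rightarrow> complex" where
  "walk_char p \<xi> = measure_pmf.expectation step_law (\<lambda>k. measure_pmf.expectation p (fourier_char \<xi>) ^ k)"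

lemma walk_char_eq: "walk_char p \<xi> = 1 - Psi (1 - measure_pmf.expectation p (fourier_char \<xi>))"
  unfolding walk_char_def by (rule expectation_power_step[OF norm_expectation_fourier_char_le])

lemma norm_walk_char_le_1: "norm (walk_char p \<xi>) \<le> 1"
proof -
  have "norm (walk_char p \<xi>) \<le> measure_pmf.expectation step_law (\<lambda>k. norm (measure_pmf.expectation p (fourier_char \<xi>) ^ k))"
    unfolding walk_char_def by (rule integral_norm_bound)
  also have "\<dots> \<le> measure_pmf.expectation step_law (\<lambda>k. 1)"
    by (intro integral_mono measure_pmf.integrable_const_bound[where B = 1])
       (auto simp: norm_power power_le_one norm_expectation_fourier_char_le)
  finally show ?thesis by simp
qed

lemma continuous_on_walk_char:
  assumes "finite (set_pmf p)"
  shows "continuous_on A (walk_char p)"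
  unfolding walk_char_def
  by (rule continuous_on_compose2[OF continuous_on_expectation_power
        continuous_on_expectation_fourier_char[OF assms]])
     (auto simp: norm_expectation_fourier_char_le)

text \<open>A bound of exponential form, so that n-th powers turn into n times a value of \<psi>.
  Near 0 the cone condition gives 1 - 3/4 \<open>\<psi> x\<close>; elsewhere compactness gives a
  constant below 1, which a small enough \<kappa> brings into the same form.\<close>

lemma norm_walk_char_bound:
  fixes p :: "(int ^ 'd::finite) pmf"
  assumes p: "class_S p" and nontriv: "\<not> (AE s in \<nu>. s = 0)"
  obtains \<kappa> c where "\<kappa> > 0" "c > 0"
    "\<And>\<xi>. \<xi> \<in> fourier_cube \<Longrightarrow> norm (walk_char p \<xi>) \<le> exp (- (\<kappa> * \<psi> (c * (norm \<xi>)\<^sup>2)))"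
proof -
  let ?\<phi> = "\<lambda>\<xi>. measure_pmf.expectation p (fourier_char \<xi>)"
  have fin: "finite (set_pmf p)" using p by (simp add: class_S_def)
  obtain c \<delta> where c: "c > 0" "\<delta> > 0"
    "\<And>\<xi>. norm \<xi> \<le> \<delta> \<Longrightarrow> c * (norm \<xi>)\<^sup>2 \<le> 1 - Re (?\<phi> \<xi>)"
    "\<And>\<xi>. norm \<xi> \<le> \<delta> \<Longrightarrow> 1 - Re (?\<phi> \<xi>) \<le> 1"
    "\<And>\<xi>. norm \<xi> \<le> \<delta> \<Longrightarrow> \<bar>Im (?\<phi> \<xi>)\<bar> \<le> (1 - Re (?\<phi> \<xi>)) / 4"
    using expectation_fourier_char_near_0[OF p] by blast
  have psi_nn: "\<psi> t \<ge> 0" if "t \<ge> 0" for t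
    using psi_pos[of t] psi_0 that by (cases "t = 0") auto
  have near: "norm (walk_char p \<xi>) \<le> exp (- (3 / 4 * \<psi> (c * (norm \<xi>)\<^sup>2)))" if "norm \<xi> \<le> \<delta>" for \<xi>
  proof (cases "\<xi> = 0")
    case True
    thus ?thesis using norm_walk_char_le_1 psi_0 by simp
  next
    case False
    define x where "x = 1 - Re (?\<phi> \<xi>)"
    have cx: "0 < c * (norm \<xi>)\<^sup>2" using c False by simp
    have x: "x > 0" "x \<le> 1" "c * (norm \<xi>)\<^sup>2 \<le> x" "\<bar>- Im (?\<phi> \<xi>)\<bar> \<le> x / 4"
      using c(3-5)[OF that] cx by (auto simp: x_def)
    have px: "0 \<le> \<psi> x" "\<psi> x \<le> 1" "\<psi> (c * (norm \<xi>)\<^sup>2) \<le> \<psi> x"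
      using psi_nn[of x] mono_onD[OF mono_psi, of x 1] mono_onD[OF mono_psi, of "c * (norm \<xi>)\<^sup>2" x] x cx psi_1
      by auto
    have z: "1 - ?\<phi> \<xi> = Complex x (- Im (?\<phi> \<xi>))" by (simp add: complex_eq_iff x_def)
    have "norm (Psi (1 - ?\<phi> \<xi>) - of_real (\<psi> x)) \<le> \<bar>- Im (?\<phi> \<xi>)\<bar> / x * \<psi> x"
      unfolding z by (rule norm_Psi_diff_le[OF x(1)])
    also have "\<dots> \<le> 1 / 4 * \<psi> x"
      using x px by (intro mult_right_mono) (auto simp: field_simps)
    finally have d: "norm (of_real (\<psi> x) - Psi (1 - ?\<phi> \<xi>)) \<le> 1 / 4 * \<psi> x" by (simp add: norm_minus_commute)
    have eq: "walk_char p \<xi> = of_real (1 - \<psi> x) + (of_real (\<psi> x) - Psi (1 - ?\<phi> \<xi>))"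
      by (simp add: walk_char_eq)
    have "norm (walk_char p \<xi>) \<le> norm (complex_of_real (1 - \<psi> x)) + 1 / 4 * \<psi> x"
      unfolding eq by (rule order_trans[OF norm_triangle_ineq add_left_mono[OF d]])
    also have "norm (complex_of_real (1 - \<psi> x)) = 1 - \<psi> x" using px by (simp only: norm_of_real)
    finally have "norm (walk_char p \<xi>) \<le> 1 + (- (3 / 4 * \<psi> x))" by simp
    also have "\<dots> \<le> exp (- (3 / 4 * \<psi> x))" by (rule exp_ge_add_one_self)
    also have "\<dots> \<le> exp (- (3 / 4 * \<psi> (c * (norm \<xi>)\<^sup>2)))" using px by simp
    finally show ?thesis .
  qed
  have cpt: "compact ((fourier_cube :: (real ^ 'd) set) - ball 0 \<delta>)"
    by (intro compact_diff) (auto simp: fourier_cube_def)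
  obtain \<rho> where \<rho>: "0 < \<rho>" "\<rho> < 1" "\<And>\<xi>. \<xi> \<in> fourier_cube - ball 0 \<delta> \<Longrightarrow> norm (walk_char p \<xi>) \<le> \<rho>"
  proof (cases "(fourier_cube :: (real ^ 'd) set) - ball 0 \<delta> = {}")
    case True
    show ?thesis by (rule that[of "1/2"]) (use True in auto)
  next
    case False
    have "continuous_on (fourier_cube - ball 0 \<delta>) (\<lambda>\<xi>. norm (walk_char p \<xi>))"
      by (intro continuous_intros continuous_on_walk_char fin)
    from continuous_attains_sup[OF cpt False this] obtain w where w: "w \<in> fourier_cube - ball 0 \<delta>"
      "\<And>\<xi>. \<xi> \<in> fourier_cube - ball 0 \<delta> \<Longrightarrow> norm (walk_char p \<xi>) \<le> norm (walk_char p w)" by blast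
    have "w \<noteq> 0" using w(1) c by auto
    hence "?\<phi> w \<noteq> 1" using expectation_fourier_char_eq_1[OF p, of w] w(1) by auto
    hence "norm (walk_char p w) < 1" unfolding walk_char_def
      by (intro norm_expectation_power_step_less[OF nontriv norm_expectation_fourier_char_le])
    \<comment> \<open>The maximum with 1/2 keeps \<rho> positive, as its logarithm is taken
      below.\<close>
    thus ?thesis using w(2) by (intro that[of "max (1/2) (norm (walk_char p w))"]) (auto simp: le_max_iff_disj)
  qed
  obtain B where B: "B > 0" "\<And>\<xi>. \<xi> \<in> (fourier_cube :: (real ^ 'd) set) \<Longrightarrow> norm \<xi> \<le> B"
    using bounded_cbox[of "(\<chi> i. - pi) :: real ^ 'd" "\<chi> i. pi"] unfolding bounded_pos fourier_cube_def by blast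
  define T where "T = \<psi> (c * B\<^sup>2)"
  have T: "T > 0" using B c by (simp add: T_def psi_pos)
  have r: "- ln \<rho> / T > 0" using T \<rho> by (intro divide_pos_pos) auto
  \<comment> \<open>\<open>T\<close> bounds \<open>\<psi> (c * |\<xi>|^2)\<close> on the whole cube,
    so \<open>\<kappa> * T <= - ln \<rho>\<close> makes the constant bound \<rho> imply the
    exponential one.\<close>
  define \<kappa> where "\<kappa> = min (3 / 4) (- ln \<rho> / T)"
  show ?thesis
  proof (rule that)
    show "\<kappa> > 0" unfolding \<kappa>_def using r by (simp only: min_less_iff_conj) simp
    show "c > 0" by (rule c)
    fix \<xi> :: "real ^ 'd" assume \<xi>: "\<xi> \<in> fourier_cube"
    let ?t = "\<psi> (c * (norm \<xi>)\<^sup>2)"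
    have t: "0 \<le> ?t" using c by (intro psi_nn) auto
    show "norm (walk_char p \<xi>) \<le> exp (- (\<kappa> * ?t))"
    proof (cases "norm \<xi> \<le> \<delta>")
      case True
      have "\<kappa> * ?t \<le> 3 / 4 * ?t" using t unfolding \<kappa>_def by (intro mult_right_mono min.cobounded1)
      thus ?thesis using near[OF True] by (meson exp_le_cancel_iff neg_le_iff_le order_trans)
    next
      case False
      have "norm (walk_char p \<xi>) \<le> \<rho>" using \<xi> False by (intro \<rho>) auto
      also have "\<rho> = exp (- (- ln \<rho> / T * T))" using T \<rho> by simp
      also have "\<dots> \<le> exp (- (\<kappa> * ?t))"
      proof -
        have "(norm \<xi>)\<^sup>2 \<le> B\<^sup>2" using B(2)[OF \<xi>] by (intro power_mono) auto
        hence "?t \<le> T" unfolding T_def using c by (intro mono_onD[OF mono_psi]) auto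
        moreover have "\<kappa> \<le> - ln \<rho> / T" unfolding \<kappa>_def by (rule min.cobounded2)
        moreover have "0 \<le> - ln \<rho> / T" using r by (rule less_imp_le)
        ultimately have "\<kappa> * ?t \<le> - ln \<rho> / T * T" using t by (intro mult_mono)
        thus ?thesis by simp
      qed
      finally show ?thesis .
    qed
  qed
qed

text \<open>The argument of \<open>Psi\<close> equals \<open>x n\<close> times A + iC, where A tends
  to the quadratic form q and C to 0. Since n = 1 / \<open>\<psi> (x n)\<close>, the main term is a
  ratio with limit \<open>q powr \<beta>\<close>, and the relative error |C| / A vanishes. The point
  u = 0 is separate because q must be positive.\<close>

lemma walk_char_power_tendsto:
  fixes p :: "(int ^ 'd::finite) pmf"
  assumes p: "class_S p" and rv: "regularly_varying_at_0 \<psi> \<beta>"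
    and x: "filterlim x (at_right 0) sequentially"
    and nx: "\<And>n. n > 0 \<Longrightarrow> real n * \<psi> (x n) = 1"
  shows "(\<lambda>n. walk_char p (sqrt (x n) *\<^sub>R u) ^ n) \<longlonglongrightarrow>
           of_real (exp (- (((cov_matrix p *v u) \<bullet> u / 2) powr \<beta>)))"
proof (cases "u = 0")
  case True
  have "fourier_char 0 = (\<lambda>_ :: int ^ 'd. 1)" by (simp add: fourier_char_def fun_eq_iff)
  thus ?thesis using True by (simp add: walk_char_def)
next
  case False
  let ?\<phi> = "\<lambda>\<xi>. measure_pmf.expectation p (fourier_char \<xi>)"
  define q where "q = (cov_matrix p *v u) \<bullet> u / 2"
  have q: "q > 0" using cov_matrix_pos_def[OF p False] by (simp add: q_def)
  define z where "z n = 1 - ?\<phi> (sqrt (x n) *\<^sub>R u)" for n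
  obtain K where K: "K > 0" "\<And>\<xi>. norm (1 - ?\<phi> \<xi> - of_real ((cov_matrix p *v \<xi>) \<bullet> \<xi> / 2)) \<le> K * norm \<xi> ^ 3"
    using expectation_fourier_char_expansion[OF p] by blast
  have xpos: "\<forall>\<^sub>F n in sequentially. x n > 0"
    using x unfolding filterlim_at by (auto elim: eventually_mono)
  have x0: "x \<longlonglongrightarrow> 0" using x unfolding filterlim_at by blast
  have "(\<lambda>n. K * norm u ^ 3 * sqrt (x n)) \<longlonglongrightarrow> K * norm u ^ 3 * sqrt 0" by (intro tendsto_intros x0)
  hence err0: "(\<lambda>n. K * norm u ^ 3 * sqrt (x n)) \<longlonglongrightarrow> 0" by simp
  have "(\<lambda>n. z n / of_real (x n) - of_real q) \<longlonglongrightarrow> 0"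
  proof (rule Lim_null_comparison[OF _ err0])
    show "\<forall>\<^sub>F n in sequentially. norm (z n / of_real (x n) - of_real q) \<le> K * norm u ^ 3 * sqrt (x n)"
      using xpos
    proof eventually_elim
      case (elim n)
      have "(cov_matrix p *v (sqrt (x n) *\<^sub>R u)) \<bullet> (sqrt (x n) *\<^sub>R u) / 2 = x n * q"
        using elim by (simp add: q_def matrix_vector_mult_scaleR)
      hence "norm (z n - of_real (x n * q)) \<le> K * (sqrt (x n) * norm u) ^ 3"
        using K(2)[of "sqrt (x n) *\<^sub>R u"] elim by (simp add: z_def)
      also have "\<dots> = K * norm u ^ 3 * sqrt (x n) * x n"
        using elim by (simp add: power_mult_distrib power3_eq_cube mult_ac)
      finally have "norm (z n - of_real (x n * q)) / x n \<le> K * norm u ^ 3 * sqrt (x n)"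
        using elim by (simp add: field_simps)
      moreover have "z n / of_real (x n) - of_real q = (z n - of_real (x n * q)) / of_real (x n)"
        using elim by (simp add: field_simps)
      ultimately show ?case using elim by (simp add: norm_divide)
    qed
  qed
  hence zx: "(\<lambda>n. z n / of_real (x n)) \<longlonglongrightarrow> of_real q" by (simp add: LIM_zero_iff)
  define A where "A n = Re (z n) / x n" for n
  define C where "C n = Im (z n) / x n" for n
  have A: "A \<longlonglongrightarrow> q" using tendsto_Re[OF zx] by (simp add: A_def[abs_def] Re_divide_of_real)
  have C: "C \<longlonglongrightarrow> 0" using tendsto_Im[OF zx] by (simp add: C_def[abs_def] Im_divide_of_real)
  have R: "(\<lambda>n. \<psi> (A n * x n) / \<psi> (x n)) \<longlonglongrightarrow> q powr \<beta>"
    by (rule regularly_varying_tendsto[OF rv psi_pos mono_psi x A q])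
  have Apos: "\<forall>\<^sub>F n in sequentially. A n > 0" using A q by (rule order_tendstoD)
  have "(\<lambda>n. \<bar>C n\<bar> / A n * (\<psi> (A n * x n) / \<psi> (x n))) \<longlonglongrightarrow> \<bar>0\<bar> / q * (q powr \<beta>)"
    by (intro tendsto_intros A C R) (use q in auto)
  hence E: "(\<lambda>n. \<bar>C n\<bar> / A n * (\<psi> (A n * x n) / \<psi> (x n))) \<longlonglongrightarrow> 0" by simp
  have "(\<lambda>n. of_nat n * Psi (z n) - of_real (\<psi> (A n * x n) / \<psi> (x n))) \<longlonglongrightarrow> 0"
  proof (rule Lim_null_comparison[OF _ E])
    show "\<forall>\<^sub>F n in sequentially. norm (of_nat n * Psi (z n) - of_real (\<psi> (A n * x n) / \<psi> (x n)))
        \<le> \<bar>C n\<bar> / A n * (\<psi> (A n * x n) / \<psi> (x n))"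
      using xpos Apos eventually_gt_at_top[of 0]
    proof eventually_elim
      case (elim n)
      have nn: "1 / \<psi> (x n) = real n" using nx[OF elim(3)] by (metis divide_inverse inverse_unique mult.commute mult_1)
      have "z n = Complex (A n * x n) (C n * x n)" using elim by (simp add: A_def C_def)
      hence "norm (Psi (z n) - of_real (\<psi> (A n * x n))) \<le> \<bar>C n * x n\<bar> / (A n * x n) * \<psi> (A n * x n)"
        using norm_Psi_diff_le[of "A n * x n" "C n * x n"] elim by simp
      also have "\<bar>C n * x n\<bar> / (A n * x n) = \<bar>C n\<bar> / A n" using elim by (simp add: abs_mult)
      finally have "real n * norm (Psi (z n) - of_real (\<psi> (A n * x n))) \<le> real n * (\<bar>C n\<bar> / A n * \<psi> (A n * x n))"
        by (intro mult_left_mono) auto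
      moreover have "\<psi> (A n * x n) / \<psi> (x n) = real n * \<psi> (A n * x n)" using nn by (metis mult.commute times_divide_eq_right mult_1_right)
      moreover have "of_nat n * Psi (z n) - of_real (real n * \<psi> (A n * x n)) = of_nat n * (Psi (z n) - of_real (\<psi> (A n * x n)))"
        by (simp add: algebra_simps)
      ultimately show ?case by (simp add: norm_mult mult_ac)
    qed
  qed
  from tendsto_add[OF this tendsto_of_real[OF R, where 'a = complex]]
  have "(\<lambda>n. of_nat n * Psi (z n)) \<longlonglongrightarrow> of_real (q powr \<beta>)" by simp
  from tendsto_one_minus_power_complex[OF this]
  show ?thesis by (simp add: walk_char_eq z_def q_def exp_of_real[symmetric])
qed

end

section \<open>Passage to the limit in the rescaled Fourier integral\<close>

theorem theorem5p1:
  fixes \<alpha> a b :: real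
    and \<psi> :: "real \<Rightarrow> real"
    and \<nu> :: "real measure"
    and p :: "(int ^ 'd::finite) pmf"
  assumes "0 < \<alpha>" and "\<alpha> < 2"
    and "bernstein \<psi>"
    and "bernstein_repr \<psi> a b \<nu>"
    and "regularly_varying_at_0 \<psi> (\<alpha> / 2)"
    and "\<psi> 0 = 0" and "\<psi> 1 = 1"
    and "class_S p"
  shows "(\<lambda>n. pmf (subordinate_walk p b \<nu> n) 0) \<sim>[sequentially]
           (\<lambda>n. D_const \<alpha> (cov_matrix p)
                * the_inv_into {0..} \<psi> (1 / real n) powr (real CARD('d) / 2))"
proof -
  interpret bernstein_laplace \<psi> a b \<nu> by unfold_locales (fact assms)+
  note p = \<open>class_S p\<close>
  define \<beta> where "\<beta> = \<alpha> / 2"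
  have \<beta>: "0 < \<beta>" "\<beta> < 1" using assms by (auto simp: \<beta>_def)
  have rv: "regularly_varying_at_0 \<psi> \<beta>"
    using \<open>regularly_varying_at_0 \<psi> (\<alpha> / 2)\<close> by (simp add: \<beta>_def)
  have fin: "finite (set_pmf p)" using p by (simp add: class_S_def)
  let ?d = "CARD('d)"
  have cont: "continuous_on {0..1} \<psi>"
    using \<open>bernstein \<psi>\<close> unfolding bernstein_def by (auto intro: continuous_on_subset)

  \<comment> \<open>If \<nu> lived on {0}, \<psi> would be the identity on {0..} and its doubling
    ratio would be 2, whereas the index gives the limit \<open>2 powr \<beta>\<close> with \<beta> <
    1. Here \<alpha> < 2 enters.\<close>
  have nontriv: "\<not> (AE s in \<nu>. s = 0)"
  proof
    assume "AE s in \<nu>. s = 0"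
    note lin = AE_nu_zero_imp_linear[OF this]
    have b1: "b = 1" using lin[of 1] psi_1 by simp
    have ev: "\<forall>\<^sub>F x in at_right 0. \<psi> (2 * x) / \<psi> x = 2"
      using eventually_at_right_less[of "0::real"] by eventually_elim (simp add: lin b1)
    have "((\<lambda>x. \<psi> (2 * x) / \<psi> x) \<longlongrightarrow> 2 powr \<beta>) (at_right 0)"
      by (rule regularly_varying_ratio[OF rv psi_pos]) auto
    hence "((\<lambda>x::real. 2::real) \<longlongrightarrow> 2 powr \<beta>) (at_right 0)"
      using ev by (rule Lim_transform_eventually)
    hence "2 powr \<beta> = 2" using tendsto_unique[OF trivial_limit_at_right_real _ tendsto_const] by blast
    moreover have "2 powr \<beta> < 2 powr 1" using \<beta> by (intro powr_less_mono) auto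
    ultimately show False by simp
  qed

  \<comment> \<open>As 1 / 0 = 0, the value \<open>x 0\<close> is 0 and the properties below are
    stated for n > 0; then 1 / n <= \<open>\<psi> 1\<close>, so the intermediate value theorem on
    [0, 1] provides the preimage.\<close>
  define x where "x n = the_inv_into {0..} \<psi> (1 / real n)" for n
  have inj: "inj_on \<psi> {0..}" by (rule strict_mono_on_imp_inj_on[OF strict_mono_psi])
  have x: "0 < x n" "x n \<le> 1" "\<psi> (x n) = 1 / real n" if "n > 0" for n
  proof -
    obtain t where t: "0 \<le> t" "t \<le> 1" "\<psi> t = 1 / real n"
      using IVT'[of \<psi> 0 "1 / real n" 1] cont psi_0 psi_1 \<open>n > 0\<close> by auto
    hence "x n = t" unfolding x_def using the_inv_into_f_f[OF inj, of t] by simp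
    thus "x n \<le> 1" "\<psi> (x n) = 1 / real n" using t by auto
    thus "0 < x n" using t psi_0 \<open>n > 0\<close> \<open>x n = t\<close> by (cases "t = 0") auto
  qed
  have xlim: "filterlim x (at_right 0) sequentially"
    unfolding filterlim_at
  proof (intro conjI)
    show "\<forall>\<^sub>F n in sequentially. x n \<in> {0<..} \<and> x n \<noteq> 0"
      using eventually_gt_at_top[of 0]
    proof eventually_elim
      case (elim n)
      with x(1)[of n] show ?case by simp
    qed
    show "x \<longlonglongrightarrow> 0"
    proof (rule order_tendstoI)
      fix e :: real assume "e < 0"
      show "\<forall>\<^sub>F n in sequentially. e < x n"
        using eventually_gt_at_top[of 0]
      proof eventually_elim
        case (elim n)
        with x(1)[of n] \<open>e < 0\<close> show ?case by linarith
      qed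
    next
      fix e :: real assume e: "0 < e"
      have "\<forall>\<^sub>F n in sequentially. 1 / real n < \<psi> e"
        using lim_1_over_n psi_pos[OF e] by (rule order_tendstoD)
      thus "\<forall>\<^sub>F n in sequentially. x n < e" using eventually_gt_at_top[of 0]
      proof eventually_elim
        case (elim n)
        show "x n < e"
        proof (rule ccontr)
          assume "\<not> x n < e"
          hence "\<psi> e \<le> \<psi> (x n)" using e by (intro mono_onD[OF mono_psi]) auto
          thus False using elim x by simp
        qed
      qed
    qed
  qed

  define G where "G n u = indicat_real fourier_cube (sqrt (x n) *\<^sub>R u) *\<^sub>R walk_char p (sqrt (x n) *\<^sub>R u) ^ n"
    for n and u :: "real ^ 'd"
  define f where "f u = exp (- (((cov_matrix p *v u) \<bullet> u / 2) powr \<beta>))" for u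
  have [measurable]: "walk_char p \<in> borel_measurable borel"
    by (intro borel_measurable_continuous_onI continuous_on_walk_char fin)
  have [measurable]: "(fourier_cube :: (real ^ 'd) set) \<in> sets borel" by (simp add: fourier_cube_def)
  have [measurable]: "(\<lambda>u. cov_matrix p *v u) \<in> borel_measurable borel"
    by (intro borel_measurable_continuous_onI linear_continuous_on)
       (simp add: matrix_vector_mul_bounded_linear)
  have fmeas: "f \<in> borel_measurable borel" unfolding f_def by measurable
  have Gmeas: "G n \<in> borel_measurable borel" for n unfolding G_def by measurable

  have pmf_eq: "(2 * pi) ^ ?d * complex_of_real (pmf (subordinate_walk p b \<nu> n) 0)
      = of_real (x n powr (?d / 2)) * (\<integral>u. G n u \<partial>lborel)" if "n > 0" for n
  proof -
    have "(2 * pi) ^ ?d * complex_of_real (pmf (subordinate_walk p b \<nu> n) 0)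
      = (\<integral>\<xi>. indicat_real fourier_cube \<xi> *\<^sub>R walk_char p \<xi> ^ n \<partial>lborel)"
      using fourier_inversion_zero[of "subordinate_walk p b \<nu> n"]
      by (simp add: expectation_subordinate_walk walk_char_def)
    also have "\<dots> = of_real (sqrt (x n) ^ DIM(real ^ 'd)) * (\<integral>u. G n u \<partial>lborel)"
      unfolding G_def by (rule integral_lborel_scale) (use x[OF that] in auto)
    also have "sqrt (x n) ^ DIM(real ^ 'd) = x n powr (?d / 2)"
      using x[OF that] by (simp add: powr_half_sqrt[symmetric] powr_realpow[symmetric] powr_powr)
    finally show ?thesis .
  qed

  have Glim: "(\<lambda>n. G n u) \<longlonglongrightarrow> of_real (f u)" for u
  proof -
    have "(\<lambda>n. walk_char p (sqrt (x n) *\<^sub>R u) ^ n) \<longlonglongrightarrow> of_real (f u)"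
      unfolding f_def by (rule walk_char_power_tendsto[OF p rv xlim]) (use x in auto)
    moreover have "\<forall>\<^sub>F n in sequentially. walk_char p (sqrt (x n) *\<^sub>R u) ^ n = G n u"
    proof -
      have "x \<longlonglongrightarrow> 0" using xlim unfolding filterlim_at by blast
      hence "(\<lambda>n. norm (sqrt (x n) *\<^sub>R u)) \<longlonglongrightarrow> norm (sqrt 0 *\<^sub>R u)" by (intro tendsto_intros)
      hence "\<forall>\<^sub>F n in sequentially. norm (sqrt (x n) *\<^sub>R u) < 1" by (intro order_tendstoD(2)) auto
      thus ?thesis
      proof eventually_elim
        case (elim n)
        have "\<bar>(sqrt (x n) *\<^sub>R u) $ i\<bar> \<le> pi" for i
          using component_le_norm_cart[of "sqrt (x n) *\<^sub>R u" i] elim pi_gt3 by linarith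
        hence "sqrt (x n) *\<^sub>R u \<in> fourier_cube"
          unfolding fourier_cube_def mem_box_cart by (simp add: abs_le_iff minus_le_iff)
        thus ?case by (simp add: G_def)
      qed
    qed
    ultimately show ?thesis by (rule Lim_transform_eventually)
  qed

  obtain \<kappa> c where \<kappa>: "\<kappa> > 0" "c > 0"
    "\<And>\<xi>. \<xi> \<in> fourier_cube \<Longrightarrow> norm (walk_char p \<xi>) \<le> exp (- (\<kappa> * \<psi> (c * (norm \<xi>)\<^sup>2)))"
    using norm_walk_char_bound[OF p nontriv] by blast
  obtain B where B: "B > 0" "\<And>\<xi>. \<xi> \<in> (fourier_cube :: (real ^ 'd) set) \<Longrightarrow> norm \<xi> \<le> B"
    using bounded_cbox[of "(\<chi> i. - pi) :: real ^ 'd" "\<chi> i. pi"] unfolding bounded_pos fourier_cube_def by blast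
  have "c * B\<^sup>2 > 0" using \<kappa> B by simp
  then obtain C where C: "C > 0"
    "\<And>s t. 0 < s \<Longrightarrow> s \<le> t \<Longrightarrow> t \<le> c * B\<^sup>2 \<Longrightarrow> \<psi> t \<ge> C * (t / s) powr (\<beta> / 2) * \<psi> s"
    using potter_lower_bound[OF rv psi_pos mono_psi \<beta>(1), of "c * B\<^sup>2"] by blast
  define g where "g = \<beta> / 2"
  \<comment> \<open>Chosen so that \<kappa> C (c |u|^2)^g takes the form (a' |u|^2)^g, whose
    exponential is already known to be integrable.\<close>
  define a' where "a' = (\<kappa> * C) powr (1 / g) * c"
  have g: "g > 0" and a': "a' > 0" using \<beta> \<kappa> C by (auto simp: g_def a'_def)
  define w where "w u = exp (\<kappa> * C) * exp (- ((a' * (norm u)\<^sup>2) powr g))" for u :: "real ^ 'd"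
  have wint: "integrable lborel w"
    unfolding w_def using integrable_exp_minus_norm_powr[OF a' g] by simp
  have a'g: "(a' * (norm u)\<^sup>2) powr g = \<kappa> * C * (c * (norm u)\<^sup>2) powr g" for u :: "real ^ 'd"
  proof -
    have "(a' * (norm u)\<^sup>2) powr g = ((\<kappa> * C) powr (1 / g) * (c * (norm u)\<^sup>2)) powr g"
      by (simp add: a'_def mult_ac)
    also have "\<dots> = ((\<kappa> * C) powr (1 / g)) powr g * (c * (norm u)\<^sup>2) powr g"
      by (rule powr_mult)
    also have "((\<kappa> * C) powr (1 / g)) powr g = \<kappa> * C" using g \<kappa> C by (simp add: powr_powr)
    finally show ?thesis .
  qed
  have bound: "norm (G n u) \<le> w u" if n: "n > 0" for n u
  proof (cases "sqrt (x n) *\<^sub>R u \<in> fourier_cube")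
    case False
    thus ?thesis by (simp add: G_def w_def)
  next
    case True
    let ?\<xi> = "sqrt (x n) *\<^sub>R u"
    have n\<xi>: "c * (norm ?\<xi>)\<^sup>2 = x n * (c * (norm u)\<^sup>2)"
      using x[OF n] by (simp add: power_mult_distrib)
    have G1: "norm (G n u) \<le> norm (walk_char p ?\<xi>) ^ n"
      using True by (simp add: G_def norm_power)
    show ?thesis
    proof (cases "c * (norm u)\<^sup>2 \<ge> 1")
      case ge: True
      have "norm (walk_char p ?\<xi>) ^ n \<le> exp (- (\<kappa> * \<psi> (c * (norm ?\<xi>)\<^sup>2))) ^ n"
        by (intro power_mono \<kappa> True) auto
      also have "\<dots> = exp (- (\<kappa> * (real n * \<psi> (x n * (c * (norm u)\<^sup>2)))))"
        unfolding n\<xi> by (simp add: exp_of_nat_mult[symmetric] mult_ac)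
      also have "\<dots> \<le> exp (- (\<kappa> * (C * (c * (norm u)\<^sup>2) powr g)))"
      proof -
        \<comment> \<open>The Potter bound is used with s = \<open>x n\<close> and t = c |\<xi>|^2:
          membership in the cube gives t <= c B^2, the case assumption gives s <= t, and the factor
          n cancels \<open>\<psi> (x n)\<close>.\<close>
        have "x n * (c * (norm u)\<^sup>2) \<le> c * B\<^sup>2"
          unfolding n\<xi>[symmetric] using \<kappa> B(2)[OF True] by (intro mult_left_mono power_mono) auto
        moreover have "x n \<le> x n * (c * (norm u)\<^sup>2)" using x[OF n] ge by simp
        ultimately have "C * (x n * (c * (norm u)\<^sup>2) / x n) powr g * \<psi> (x n) \<le> \<psi> (x n * (c * (norm u)\<^sup>2))"
          using C(2)[of "x n" "x n * (c * (norm u)\<^sup>2)"] x[OF n] by (simp only: g_def)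
        hence "C * (c * (norm u)\<^sup>2) powr g / real n \<le> \<psi> (x n * (c * (norm u)\<^sup>2))"
          using x[OF n] by simp
        hence "C * (c * (norm u)\<^sup>2) powr g \<le> real n * \<psi> (x n * (c * (norm u)\<^sup>2))"
          using n by (simp add: field_simps)
        thus ?thesis using \<kappa> by simp
      qed
      also have "\<dots> = exp (- ((a' * (norm u)\<^sup>2) powr g))" by (simp add: a'g mult_ac)
      also have "\<dots> \<le> w u"
        unfolding w_def using \<kappa> C by (simp add: mult_le_cancel_right1)
      finally show ?thesis using G1 by linarith
    next
      case lt: False
      have "norm (walk_char p ?\<xi>) ^ n \<le> 1" by (intro power_le_one norm_walk_char_le_1) auto
      also have "1 \<le> exp (\<kappa> * C + (- ((a' * (norm u)\<^sup>2) powr g)))"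
      proof -
        have "(c * (norm u)\<^sup>2) powr g \<le> 1 powr g" using lt \<kappa> g by (intro powr_mono2) auto
        hence "\<kappa> * C * (c * (norm u)\<^sup>2) powr g \<le> \<kappa> * C * 1" using \<kappa> C by (intro mult_left_mono) auto
        thus ?thesis unfolding a'g by simp
      qed
      also have "\<dots> = w u" unfolding w_def exp_add ..
      finally show ?thesis using G1 by linarith
    qed
  qed

  \<comment> \<open>The shift avoids n = 0, where \<open>x 0 = 0\<close> makes \<open>G 0\<close>
    constantly 1 and hence not dominated by any integrable function.\<close>
  have "(\<lambda>n. \<integral>u. G (Suc n) u \<partial>lborel) \<longlonglongrightarrow> (\<integral>u. complex_of_real (f u) \<partial>lborel)"
  proof (rule integral_dominated_convergence[OF _ _ wint])
    show "(\<lambda>u. complex_of_real (f u)) \<in> borel_measurable lborel" using fmeas by simp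
    show "G (Suc n) \<in> borel_measurable lborel" for n using Gmeas by simp
    show "AE u in lborel. (\<lambda>n. G (Suc n) u) \<longlonglongrightarrow> of_real (f u)"
      by (intro AE_I2 LIMSEQ_Suc Glim)
    show "AE u in lborel. norm (G (Suc n) u) \<le> w u" for n
      by (intro AE_I2 bound) simp
  qed
  hence lim: "(\<lambda>n. \<integral>u. G n u \<partial>lborel) \<longlonglongrightarrow> (\<integral>u. complex_of_real (f u) \<partial>lborel)"
    by (rule LIMSEQ_imp_Suc)

  let ?Q = "cov_matrix p"
  define I where "I = (2 * pi) powr (?d / 2) * (Gamma (1 + ?d / (2 * \<beta>)) / Gamma (1 + ?d / 2)) * det ?Q powr (- (1/2))"
  have detQ: "det ?Q > 0"
    by (rule ellipsoid_measure(1)[OF transpose_cov_matrix cov_matrix_pos_def[OF p], of 0]) auto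
  have Ipos: "I > 0"
    unfolding I_def using \<beta> detQ by (intro mult_pos_pos divide_pos_pos Gamma_real_pos add_pos_nonneg) auto
  have "(\<integral>\<^sup>+u. ennreal (f u) \<partial>lborel) = ennreal I"
    unfolding f_def I_def
    by (rule nn_integral_exp_quadratic_powr[OF transpose_cov_matrix cov_matrix_pos_def[OF p] \<beta>(1)])
  hence "(\<integral>u. f u \<partial>lborel) = I"
    by (subst integral_eq_nn_integral) (use fmeas Ipos in \<open>auto simp: f_def\<close>)
  hence fint: "(\<integral>u. complex_of_real (f u) \<partial>lborel) = of_real I" by (simp add: integral_complex_of_real)

  \<comment> \<open>Fourier inversion divides by (2 pi)^d, which turns the exponent d/2 of the
    ellipsoid integral into the -d/2 of \<open>D_const\<close>.\<close>
  have D: "D_const \<alpha> ?Q = I / (2 * pi) ^ ?d"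
  proof -
    have "(2 * pi) powr (?d / 2) / (2 * pi) ^ ?d = (2 * pi) powr (- (?d / 2))"
    proof -
      have "(2 * pi) ^ ?d = (2 * pi) powr real ?d" by (rule powr_realpow[symmetric]) simp
      hence "(2 * pi) powr (?d / 2) / (2 * pi) ^ ?d = (2 * pi) powr (?d / 2 - ?d)" by (simp only: powr_diff)
      also have "?d / 2 - ?d = - (?d / 2)" by simp
      finally show ?thesis .
    qed
    moreover have "I / (2 * pi) ^ ?d = (2 * pi) powr (?d / 2) / (2 * pi) ^ ?d *
        (Gamma (1 + ?d / (2 * \<beta>)) / Gamma (1 + ?d / 2)) * det ?Q powr (- (1/2))"
      by (simp add: I_def)
    moreover have "2 * \<beta> = \<alpha>" by (simp add: \<beta>_def)
    ultimately show ?thesis by (simp only: D_const_def)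
  qed
  have Dpos: "D_const \<alpha> ?Q > 0" unfolding D using Ipos by simp
  have lim': "(\<lambda>n. Re ((\<integral>u. G n u \<partial>lborel) / (2 * pi) ^ ?d)) \<longlonglongrightarrow> I / (2 * pi) ^ ?d"
    using tendsto_Re[OF tendsto_divide[OF lim[unfolded fint] tendsto_const, of "(2 * pi) ^ ?d"]] by simp
  have "(\<lambda>n. Re ((\<integral>u. G n u \<partial>lborel) / (2 * pi) ^ ?d)) \<longlonglongrightarrow> D_const \<alpha> ?Q"
    using lim' by (simp add: D)
  moreover have "\<forall>\<^sub>F n in sequentially. Re ((\<integral>u. G n u \<partial>lborel) / (2 * pi) ^ ?d)
      = pmf (subordinate_walk p b \<nu> n) 0 / x n powr (?d / 2)"
    using eventually_gt_at_top[of 0]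
  proof eventually_elim
    case (elim n)
    have "x n powr (?d / 2) > 0" using x[OF elim] by simp
    hence "(\<integral>u. G n u \<partial>lborel) / (2 * pi) ^ ?d = of_real (pmf (subordinate_walk p b \<nu> n) 0 / x n powr (?d / 2))"
      using pmf_eq[OF elim] by (simp add: field_simps)
    thus ?case by simp
  qed
  ultimately have "(\<lambda>n. pmf (subordinate_walk p b \<nu> n) 0 / x n powr (?d / 2)) \<longlonglongrightarrow> D_const \<alpha> ?Q"
    by (rule Lim_transform_eventually)
  \<comment> \<open>A limit of ratios yields asymptotic equivalence only when it is nonzero, hence
    the positivity of the constant.\<close>
  from asymp_equivI'_const[OF this] Dpos show ?thesis by (simp add: x_def)
qed

end
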